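(* Let $G$ and $H$ be finite abelian groups. Then $|\mathsf M(G,|H|)|=|\mathsf M(H,|G|)|$ if and only if $\varphi_G(d)=\varphi_H(d)$ for every positive integer $d$ dividing $\gcd(|G|,|H|)$.
   Context: For a finite abelian group $G$ (written additively) and a positive integer $m$, a sequence over $G$ of length $m$ is an unordered finite list $g_1\cdots g_m$ of elements of $G$ with repetition allowed (i.e. a multiset of size $m$); it is a zero-sum sequence if $g_1+\cdots+g_m=0$. $\mathsf M(G,m)$ denotes the set of all zero-sum sequences over $G$ of length $m$. For a finite group $G$ and positive integer $d$, $\varphi_G(d)$ denotes the number of elements of $G$ of order exactly $d$. *)

theory Defs
  imports "HOL-Algebra.Multiplicative_Group" "HOL-Library.Multiset"
begin

(* HOL-Algebra writes groups multiplicatively: "zero-sum" here means that the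
   product of the sequence, counted with multiplicity, is the neutral element. *)

definition seq_sum :: "('a, 'b) monoid_scheme \<Rightarrow> 'a multiset \<Rightarrow> 'a" where
  "seq_sum G M = (\<Otimes>\<^bsub>G\<^esub>x\<in>set_mset M. x [^]\<^bsub>G\<^esub> count M x)"

definition zero_sum_seqs :: "('a, 'b) monoid_scheme \<Rightarrow> nat \<Rightarrow> 'a multiset set" where
  "zero_sum_seqs G m =
     {M. set_mset M \<subseteq> carrier G \<and> size M = m \<and> seq_sum G M = \<one>\<^bsub>G\<^esub>}"

definition num_of_order :: "('a, 'b) monoid_scheme \<Rightarrow> nat \<Rightarrow> nat" where
  "num_of_order G d = card {x \<in> carrier G. group.ord G x = d}"

(* seq_sum is the iterated group operation over any enumeration of the multiset. *)

lemma (in comm_monoid) seq_sum_empty: "seq_sum G {#} = \<one>"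
  by (simp add: seq_sum_def)

lemma (in comm_monoid) seq_sum_add_mset:
  assumes "x \<in> carrier G" "set_mset M \<subseteq> carrier G"
  shows "seq_sum G (add_mset x M) = x \<otimes> seq_sum G M"
proof -
  let ?R = "set_mset M - {x}"
  have R: "(\<Otimes>y\<in>?R. y [^] count (add_mset x M) y) = (\<Otimes>y\<in>?R. y [^] count M y)"
    using assms by (intro finprod_cong') auto
  have cl: "(\<Otimes>y\<in>?R. y [^] count M y) \<in> carrier G"
    using assms by (intro finprod_closed) auto
  have set: "set_mset (add_mset x M) = insert x ?R" by auto
  have "seq_sum G (add_mset x M) =
      x [^] count (add_mset x M) x \<otimes> (\<Otimes>y\<in>?R. y [^] count (add_mset x M) y)"
    unfolding seq_sum_def set using assms by (intro finprod_insert) auto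
  also have "\<dots> = x [^] Suc (count M x) \<otimes> (\<Otimes>y\<in>?R. y [^] count M y)"
    unfolding R by simp
  also have "\<dots> = x \<otimes> (x [^] count M x \<otimes> (\<Otimes>y\<in>?R. y [^] count M y))"
    using assms cl by (simp add: m_lcomm m_assoc)
  also have "x [^] count M x \<otimes> (\<Otimes>y\<in>?R. y [^] count M y) = seq_sum G M"
  proof (cases "x \<in># M")
    case True
    then have "set_mset M = insert x ?R" by auto
    then have "seq_sum G M = (\<Otimes>y\<in>insert x ?R. y [^] count M y)"
      by (simp add: seq_sum_def)
    also have "\<dots> = x [^] count M x \<otimes> (\<Otimes>y\<in>?R. y [^] count M y)"
      using assms by (subst finprod_insert) auto
    finally show ?thesis by simp
  next
    case False
    then have "?R = set_mset M" "count M x = 0" by (auto simp: not_in_iff)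
    then show ?thesis using cl by (simp add: seq_sum_def)
  qed
  finally show ?thesis .
qed

lemma (in comm_monoid) seq_sum_mset:
  assumes "set xs \<subseteq> carrier G"
  shows "seq_sum G (mset xs) = foldr (\<otimes>) xs \<one>"
  using assms by (induction xs) (simp_all add: seq_sum_empty seq_sum_add_mset)

end

(* For a finite abelian group G of order n,
     (n + m) |M(G, m)| = sum over d | gcd(n, m) of phi_G(d) f(d),  f(d) = binomial((n + m)/d, n/d),
   and f is symmetric in n and m.  The usual proof uses characters; instead, Newton's identity for
   the numbers of sequences with a prescribed sum shows that these numbers are combinations, with
   coefficients that depend only on n and m, of the numbers of solutions of z^e = h.

   It remains to see that the weighted sums differ if phi_G and phi_H differ.  Let L be the least
   d at which they do.  The numbers of solutions of x^L = 1 in G and in H are then distinct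
   multiples of L, so |phi_G(L) - phi_H(L)| >= L, while f decreases so fast that the terms with
   d >= 2 L cannot make up for this.  Discrepancies d < 2 L are pairwise coprime prime powers.
   If there are any besides L, then the orders n and m are so large that these terms are
   negligible as well. *)

theory Submission
  imports Defs "HOL-Algebra.Sylow"
begin

section \<open>Binomial coefficients\<close>

text \<open>One term of Vandermonde's sum suffices. This supermultiplicativity bounds the ratio of
  two weights from below by a third binomial coefficient.\<close>

lemma binomial_mult_le:
  fixes a b x y :: nat
  shows "((a + b) choose a) * ((x + y) choose x) \<le> ((a + x) + (b + y)) choose (a + x)"
proof -
  have "((a + b) choose a) * ((x + y) choose (a + x - a))
      \<le> (\<Sum>k\<le>a + x. ((a + b) choose k) * ((x + y) choose (a + x - k)))"
    by (rule member_le_sum) auto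
  also have "\<dots> = ((a + b) + (x + y)) choose (a + x)"
    by (rule vandermonde)
  finally show ?thesis
    by (simp add: algebra_simps)
qed

text \<open>Entries of a row increase up to the middle, and the row is symmetric. It serves to
  replace a coefficient of unknown lower index by one with lower index 2, 3 or 4.\<close>

lemma binomial_add_le:
  fixes j x y :: nat
  assumes "j \<le> x" "j \<le> y"
  shows "(x + y) choose j \<le> (x + y) choose x"
proof (cases "x \<le> y")
  case True
  then show ?thesis using assms by (intro binomial_mono) auto
next
  case False
  then have "(x + y) choose j \<le> (x + y) choose y" using assms by (intro binomial_mono) auto
  then show ?thesis using binomial_symmetric[of x "x + y"] by simp
qed

lemma two_times_choose_two: "2 * (n choose 2) = n * (n - 1)"
  by (cases n) (simp_all add: choose_two)

text \<open>The additive 6 makes the induction start: at \<open>n = 6\<close> the two sides are 24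
  and 26, whereas \<open>6 choose 3\<close> alone is 20.\<close>

lemma choose_three_ge:
  fixes n :: nat
  assumes "6 \<le> n"
  shows "4 * n \<le> (n choose 3) + 6"
  using assms
proof (induction n rule: dec_induct)
  case base
  show ?case by (simp add: numeral_eq_Suc)
next
  case (step n)
  have "2 * (n choose 2) \<ge> n * 5"
    unfolding two_times_choose_two using step by (intro mult_le_mono) auto
  moreover have "Suc n choose 3 = (n choose 2) + (n choose 3)"
    by (simp add: numeral_eq_Suc)
  ultimately show ?case using step by simp
qed

lemma choose_four_ge:
  fixes n :: nat
  assumes "8 \<le> n"
  shows "n\<^sup>2 \<le> n choose 4"
  using assms
proof (induction n rule: dec_induct)
  case base
  show ?case by (simp add: numeral_eq_Suc)
next
  case (step n)
  have "4 * n \<le> (n choose 3) + 6"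
    using step by (intro choose_three_ge) auto
  moreover have "Suc n choose 4 = (n choose 3) + (n choose 4)"
    by (simp add: numeral_eq_Suc)
  ultimately show ?case using step by (simp add: power2_eq_square)
qed

lemma choose_two_ge:
  fixes c n :: nat
  assumes "c \<le> n" 
  shows "c * (n - 1) \<le> 2 * (n choose 2)"
  unfolding two_times_choose_two using assms by simp

section \<open>Weights at orders of at least twice the least discrepancy\<close>

text \<open>Meant for \<open>a = n div d\<close> and \<open>A = n div L\<close> with
  \<open>d\<close> at least \<open>2 * L\<close>, and likewise for \<open>b\<close>,
  \<open>B\<close> and \<open>m\<close>. Supermultiplicativity leaves the factor
  \<open>(x + y) choose x\<close> for the differences \<open>x = A - a\<close> and
  \<open>y = B - b\<close>, and this is at least \<open>(x + y) choose 2\<close> unless a difference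
  is 1.\<close>

lemma binomial_double_le:
  fixes a b A B :: nat
  assumes ab: "0 < a" "0 < b" and le: "2 * a \<le> A" "2 * b \<le> B"
  shows "(A + B - 2) * ((a + b) choose a) \<le> (A + B) choose A"
proof -
  \<comment> \<open>The extreme case \<open>A = 2\<close>, \<open>a = 1\<close>: here
    \<open>x = 1\<close>, so \<open>(x + y) choose x\<close> is just \<open>1 + y\<close>, which can
    be too small; both coefficients are compared explicitly instead.\<close>
  have one: "(Suc 1 + B - 2) * ((1 + b) choose 1) \<le> (Suc 1 + B) choose Suc 1"
    if "2 * b \<le> B" for b B :: nat
  proof -
    have "2 * (B * (1 + b)) \<le> B * (2 + B)"
      using that by (simp add: algebra_simps)
    also have "\<dots> \<le> (2 + B) * (1 + B)"
      by (simp add: algebra_simps)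
    also have "\<dots> = 2 * ((2 + B) choose 2)"
      using two_times_choose_two[of "2 + B"] by simp
    finally show ?thesis by (simp add: numeral_2_eq_2)
  qed
  define x y where "x = A - a" and "y = B - b"
  have A: "A = a + x" "B = b + y" "a \<le> x" "b \<le> y"
    using le by (auto simp: x_def y_def)
  consider "x = 1" | "y = 1" | "x \<ge> 2" "y \<ge> 2" using A ab by linarith
  then show ?thesis
  proof cases
    case 1
    then have "a = 1" "A = Suc 1" using A ab by auto
    then show ?thesis using one[OF le(2)] by simp
  next
    case 2
    then have "b = 1" "B = Suc 1" using A ab by auto
    have sym: "(c + d) choose d = (d + c) choose c" for c d :: nat
      using binomial_symmetric[of c "c + d"] by (simp add: add.commute)
    show ?thesis
      using one[OF le(1)] sym[of a b] sym[of A B] \<open>b = 1\<close> \<open>B = Suc 1\<close>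
      by (simp add: add.commute)
  next
    case 3
    have "4 * (x + y - 1) \<le> 2 * ((x + y) choose 2)"
      using 3 by (intro choose_two_ge) auto
    moreover have "A + B - 2 \<le> 2 * (x + y - 1)" using A by simp
    ultimately have "A + B - 2 \<le> (x + y) choose 2" by simp
    also have "\<dots> \<le> (x + y) choose x" using 3 by (intro binomial_add_le) auto
    finally have "(A + B - 2) * ((a + b) choose a) \<le> ((a + b) choose a) * ((x + y) choose x)"
      by simp
    also have "\<dots> \<le> (A + B) choose A"
      unfolding A(1,2) by (rule binomial_mult_le)
    finally show ?thesis .
  qed
qed

text \<open>Roughly doubles the gain of \<open>binomial_double_le\<close>, so that the far orders
  use up at most half of the leading term when near orders compete for the other half. The condition
  \<open>large\<close> brings \<open>choose 3\<close> into reach, or else \<open>choose 2\<close> in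
  a row of index at least 8.\<close>

lemma binomial_double_le':
  fixes a b A B :: nat
  assumes le: "2 * a \<le> A" "2 * b \<le> B"
    and large: "(6 \<le> A \<and> 6 \<le> B) \<or> (3 \<le> A \<and> 12 \<le> B) \<or> (12 \<le> A \<and> 3 \<le> B)"
  shows "2 * (A + B - 3) * ((a + b) choose a) \<le> (A + B) choose A"
proof -
  define x y where "x = A - a" and "y = B - b"
  have A: "A = a + x" "B = b + y" "a \<le> x" "b \<le> y"
    using le by (auto simp: x_def y_def)
  have "2 * (2 * (x + y) - 3) \<le> (x + y) choose x"
  proof (cases "x \<ge> 3 \<and> y \<ge> 3")
    case True
    then have "4 * (x + y) \<le> ((x + y) choose 3) + 6"
      by (intro choose_three_ge) auto
    moreover have "(x + y) choose 3 \<le> (x + y) choose x"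
      using True by (intro binomial_add_le) auto
    ultimately show ?thesis by linarith
  next
    case False
    \<comment> \<open>If one of \<open>x\<close>, \<open>y\<close> is below 3, then \<open>A\<close>
      or \<open>B\<close> is at most 4, so only an alternative of \<open>large\<close> with a 12
      remains; it makes the other difference at least 6.\<close>
    then have xy: "x \<ge> 2" "y \<ge> 2" "8 \<le> x + y" using large A by linarith+
    then have "8 * (x + y - 1) \<le> 2 * ((x + y) choose 2)"
      by (intro choose_two_ge) auto
    moreover have "(x + y) choose 2 \<le> (x + y) choose x"
      using xy by (intro binomial_add_le) auto
    moreover have "2 * (2 * (x + y) - 3) \<le> 4 * (x + y - 1)" by simp
    ultimately show ?thesis by linarith
  qed
  moreover have "2 * (A + B - 3) \<le> 2 * (2 * (x + y) - 3)" using A by simp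
  ultimately have "2 * (A + B - 3) \<le> (x + y) choose x" by linarith
  then have "2 * (A + B - 3) * ((a + b) choose a) \<le> ((a + b) choose a) * ((x + y) choose x)"
    by simp
  also have "\<dots> \<le> (A + B) choose A"
    unfolding A(1,2) by (rule binomial_mult_le)
  finally show ?thesis .
qed

section \<open>Weights at orders between the least discrepancy and its double\<close>

text \<open>Two Vandermonde terms are kept, \<open>k = L\<close> and \<open>k = Suc L\<close>. The
  first alone would give only the factor \<open>1 + v\<close> between the two coefficients, which
  for large \<open>v\<close> is too small in the case \<open>u = 1\<close>, \<open>d = L + 1\<close>
  of the near terms.\<close>

lemma binomial_step_le:
  fixes L v :: nat
  shows "((1 + v) * Suc L + L * v) * ((L + L * v) choose L)
      \<le> Suc L * ((Suc L + Suc L * v) choose Suc L)"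
proof -
  have "((L + L * v) choose L) * (1 + v) + ((L + L * v) choose Suc L)
      = (\<Sum>k\<in>{L, Suc L}. ((L + L * v) choose k) * ((1 + v) choose (Suc L - k)))"
    by simp
  also have "\<dots> \<le> (\<Sum>k\<le>Suc L. ((L + L * v) choose k) * ((1 + v) choose (Suc L - k)))"
    by (rule sum_mono2) auto
  also have "\<dots> = ((L + L * v) + (1 + v)) choose Suc L"
    by (rule vandermonde)
  also have "(L + L * v) + (1 + v) = Suc L + Suc L * v" by simp
  finally have "Suc L * (((L + L * v) choose L) * (1 + v)) + Suc L * ((L + L * v) choose Suc L)
      \<le> Suc L * ((Suc L + Suc L * v) choose Suc L)"
    by (metis add_mult_distrib2 mult_le_mono2)
  moreover have "Suc L * ((L + L * v) choose Suc L) = L * v * ((L + L * v) choose L)"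
    using binomial_absorption[of L "L + L * v"] binomial_absorb_comp[of "L + L * v" L]
    by simp
  ultimately show ?thesis by (simp add: algebra_simps)
qed

text \<open>In the application \<open>n = L * d * u\<close> and \<open>m = L * d * v\<close>, the
  numbers of solutions of \<open>x^L = 1\<close> in the two groups are \<open>L * k\<close> and
  \<open>L * h\<close>, those of \<open>x^d = 1\<close> are \<open>d * k'\<close> and
  \<open>d * h'\<close>, and \<open>c\<close> is the number of near discrepancies. The difference of
  \<open>k'\<close> and \<open>h'\<close> is at most \<open>v - 1\<close>, while with
  \<open>j = d - L\<close> the weight at \<open>L\<close> gains the factor
  \<open>(j * u + j * v) choose (j * u)\<close> over that at \<open>d\<close>.\<close>

lemma near_term_less_aux:
  fixes L d u v k h k' h' c :: nat
  assumes L: "2 \<le> L" "L < d" "d < 2 * L"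
    and pos: "0 < u" "0 < k" "0 < h" "0 < k'" "0 < h'"
    and le: "k * k' \<le> u" "h * h' \<le> v"
    and ne: "k \<noteq> h" "k' \<noteq> h'"
    and c: "c \<le> 1 \<or> c \<le> L \<and> L \<le> u \<and> 4 \<le> u"
    and uv: "u \<le> v"
  shows "2 * int c * int d * \<bar>int k' - int h'\<bar> * int ((L * u + L * v) choose (L * u))
      < int L * \<bar>int k - int h\<bar> * int ((d * u + d * v) choose (d * u))"
proof -
  define F where "F = (L * u + L * v) choose (L * u)"
  define E where "E = (d * u + d * v) choose (d * u)"
  define j where "j = d - L"
  have d: "d = L + j" "1 \<le> j" using L by (auto simp: j_def)
  have F: "F > 0" by (simp add: F_def)
  have E: "F * ((j * u + j * v) choose (j * u)) \<le> E"
    using binomial_mult_le[of "L * u" "L * v" "j * u" "j * v"]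
    by (simp add: d F_def E_def algebra_simps)
  have kh: "1 \<le> \<bar>int k - int h\<bar>" using ne by simp
  have "1 * k' \<le> k * k'" "1 * h' \<le> h * h'" using pos by (intro mult_le_mono; simp)+
  then have k'h'_le: "k' \<le> u" "h' \<le> v" using le by linarith+
  then have k'h': "\<bar>int k' - int h'\<bar> \<le> int v - 1" using pos uv by linarith
  have "2 * c * d * nat \<bar>int k' - int h'\<bar> * F < L * E"
  proof -
    consider (one) "u = 1" | (two) "2 \<le> u" "c \<le> 1" | (many) "c \<le> L" "L \<le> u" "4 \<le> u"
      using c pos by linarith
    then show ?thesis
    proof cases
      \<comment> \<open>The tightest case. Since \<open>k = k' = 1\<close>, both \<open>h\<close>
        and \<open>h'\<close> are at least 2, and \<open>h * h' \<le> v\<close> improves the bound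
        \<open>h' - 1 \<le> v - 1\<close> by a factor of 2, to
        \<open>2 * (h' - 1) \<le> v - 2\<close>.\<close>
      case one
      have "k * 1 \<le> k * k'" using pos by (intro mult_le_mono) auto
      then have "k = 1" "k' = 1" using pos le one k'h'_le by linarith+
      then have h: "2 \<le> h" "2 \<le> h'" using ne pos by auto
      have "2 * h' \<le> h * h'" "h * 2 \<le> h * h'" using h by (intro mult_le_mono; simp)+
      then have hv: "2 * h' \<le> v" "4 \<le> v" using le h by linarith+
      have c1: "c \<le> 1" using c one by simp
      have "2 * c * d * nat \<bar>int k' - int h'\<bar> * F \<le> 2 * 1 * d * (h' - 1) * F"
        using c1 \<open>k' = 1\<close> h by (intro mult_le_mono) auto
      also have "\<dots> = d * (2 * (h' - 1)) * F" by simp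
      also have "\<dots> \<le> d * (v - 2) * F"
        using hv by (intro mult_le_mono1 mult_le_mono2) linarith
      also have "d * (v - 2) * F < L * E"
      proof (cases "j = 1")
        case True
        have "((1 + v) * d + L * v) * F \<le> d * E"
          using binomial_step_le[of v L] one True d by (simp add: F_def E_def)
        then have "L * (((1 + v) * d + L * v) * F) \<le> L * (d * E)" by (rule mult_le_mono2)
        have "d * (d * (v - 2)) < L * ((1 + v) * d + L * v)"
        proof -
          obtain w where w: "v = w + 2" using hv by (intro that[of "v - 2"]) simp
          have "w + L * w \<le> L * L * w"
          proof -
            have "1 + L \<le> L * L" using L mult_le_mono1[of 2 L L] by linarith
            then have "(1 + L) * w \<le> L * L * w" by (rule mult_le_mono1)
            then show ?thesis by simp
          qed
          then show ?thesis using True L by (simp add: d w algebra_simps)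
        qed
        from mult_less_mono1[OF this F]
        have "d * (d * (v - 2) * F) < L * (((1 + v) * d + L * v) * F)" by (simp only: mult_ac)
        also have "\<dots> \<le> L * (d * E)" by fact
        also have "\<dots> = d * (L * E)" by (rule mult.left_commute)
        finally have "d * (d * (v - 2) * F) < d * (L * E)" .
        then show ?thesis by simp
      next
        case False
        then have "2 \<le> j" using d by simp
        then have "2 \<le> j * v" using hv mult_le_mono[of 2 j 1 v] by simp
        then have "(j + j * v) choose 2 \<le> (j + j * v) choose j"
          using \<open>2 \<le> j\<close> by (intro binomial_add_le) auto
        moreover have "4 * (j + j * v - 1) \<le> 2 * ((j + j * v) choose 2)"
          using \<open>2 \<le> j\<close> \<open>2 \<le> j * v\<close> by (intro choose_two_ge) auto
        moreover have "2 * v \<le> j * v" using \<open>2 \<le> j\<close> by simp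
        ultimately have "2 * v \<le> (j + j * v) choose j" using \<open>2 \<le> j\<close> by linarith
        then have "F * (2 * v) \<le> E" using E one by (metis le_trans mult_le_mono2 mult.right_neutral)
        have "d * (v - 2) \<le> 2 * L * (v - 2)" using L by (intro mult_le_mono1) auto
        also have "\<dots> < L * (2 * v)" using L hv by simp
        finally have "d * (v - 2) * F < L * (2 * v) * F" using F by (rule mult_less_mono1)
        also have "\<dots> = L * (F * (2 * v))" by (simp only: mult_ac)
        also have "\<dots> \<le> L * E" using \<open>F * (2 * v) \<le> E\<close> by (rule mult_le_mono2)
        finally show ?thesis .
      qed
      finally show ?thesis .
    next
      case two
      have uvj: "u \<le> j * u" "v \<le> j * v" using d by simp_all
      have "(u + v) choose 2 \<le> (u + v) choose u"
        using two uv by (intro binomial_add_le) auto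
      also have "\<dots> \<le> ((u + v) choose u) * (((j * u - u) + (j * v - v)) choose (j * u - u))"
        by (simp add: Suc_le_eq)
      also have "\<dots> \<le> (j * u + j * v) choose (j * u)"
        using binomial_mult_le[of u v "j * u - u" "j * v - v"] uvj by simp
      finally have E2: "F * ((u + v) choose 2) \<le> E" using E by (meson le_trans mult_le_mono2)
      have v2: "(v + 2) * (v + 1) \<le> 2 * ((u + v) choose 2)"
        unfolding two_times_choose_two using two by (intro mult_le_mono) auto
      have "8 * (v - 1) + 1 \<le> 2 * ((u + v) choose 2)"
      proof -
        have "8 * (v - 1) + 1 \<le> (v + 2) * (v + 1)"
        proof -
          \<comment> \<open>The difference of the two sides is \<open>(v - 3)^2 + v\<close>.\<close>
          have "(int v - 3) * (int v - 3) \<ge> 0" by simp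
          moreover have "int v \<ge> 2" using two uv by simp
          ultimately have "8 * (int v - 1) + 1 \<le> (int v + 2) * (int v + 1)"
            by (simp add: algebra_simps)
          moreover have "int (8 * (v - 1) + 1) = 8 * (int v - 1) + 1"
            using two uv by (simp add: of_nat_diff)
          ultimately have "int (8 * (v - 1) + 1) \<le> int ((v + 2) * (v + 1))"
            by (simp only: of_nat_mult of_nat_add of_nat_numeral of_nat_1)
          then show ?thesis by (simp only: of_nat_le_iff)
        qed
        then show ?thesis using v2 by linarith
      qed
      then have *: "4 * (v - 1) < (u + v) choose 2" by linarith
      have "2 * c * d * nat \<bar>int k' - int h'\<bar> * F \<le> 2 * 1 * (2 * L) * (v - 1) * F"
        using two L k'h' by (intro mult_le_mono) auto
      also have "\<dots> = L * (F * (4 * (v - 1)))" by simp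
      also have "\<dots> < L * (F * ((u + v) choose 2))" using * L F by simp
      also have "\<dots> \<le> L * E" using E2 by simp
      finally show ?thesis .
    next
      case many
      have uvj: "u \<le> j * u" "v \<le> j * v" using d by simp_all
      \<comment> \<open>Since \<open>c\<close> may be as large as \<open>u\<close>, the factor to
        beat is \<open>4 * u * (v - 1)\<close>; the inequality of the means and the quadratic bound
        on \<open>choose 4\<close> supply \<open>4 * u * v\<close>.\<close>
      have "4 * (u * v) \<le> (u + v)\<^sup>2"
      proof -
        have "0 \<le> (int u - int v) * (int u - int v)" by simp
        then have "4 * (int u * int v) \<le> (int u + int v)\<^sup>2"
          by (simp add: power2_eq_square algebra_simps)
        then have "int (4 * (u * v)) \<le> int ((u + v)\<^sup>2)" by simp
        then show ?thesis by (simp only: of_nat_le_iff)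
      qed
      also have "\<dots> \<le> (u + v) choose 4"
        using many uv by (intro choose_four_ge) auto
      also have "\<dots> \<le> (u + v) choose u"
        using many uv by (intro binomial_add_le) auto
      also have "\<dots> \<le> ((u + v) choose u) * (((j * u - u) + (j * v - v)) choose (j * u - u))"
        by (simp add: Suc_le_eq)
      also have "\<dots> \<le> (j * u + j * v) choose (j * u)"
        using binomial_mult_le[of u v "j * u - u" "j * v - v"] uvj by simp
      finally have "F * (4 * (u * v)) \<le> E" using E by (meson le_trans mult_le_mono2)
      have "2 * c * d * nat \<bar>int k' - int h'\<bar> * F \<le> 2 * u * (2 * L) * (v - 1) * F"
        using many L k'h' by (intro mult_le_mono) auto
      also have "\<dots> = L * (F * (4 * (u * (v - 1))))" by simp
      also have "\<dots> < L * (F * (4 * (u * v)))" using L F many uv by simp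
      also have "\<dots> \<le> L * E" using \<open>F * (4 * (u * v)) \<le> E\<close> by simp
      finally show ?thesis .
    qed
  qed
  then have "int (2 * c * d * nat \<bar>int k' - int h'\<bar> * F) < int (L * E)"
    by (simp only: of_nat_less_iff)
  then have "2 * int c * int d * \<bar>int k' - int h'\<bar> * int F < int L * 1 * int E" by simp
  also have "\<dots> \<le> int L * \<bar>int k - int h\<bar> * int E"
    using kh by (intro mult_right_mono mult_left_mono) auto
  finally show ?thesis by (simp add: F_def E_def)
qed

lemma near_term_less:
  fixes L d u v k h k' h' c :: nat
  assumes L: "2 \<le> L" "L < d" "d < 2 * L"
    and pos: "0 < u" "0 < v" "0 < k" "0 < h" "0 < k'" "0 < h'"
    and le: "k * k' \<le> u" "h * h' \<le> v"
    and ne: "k \<noteq> h" "k' \<noteq> h'"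
    and c: "c \<le> 1 \<or> c \<le> L \<and> L \<le> u \<and> L \<le> v \<and> 4 \<le> u \<and> 4 \<le> v"
  shows "2 * int c * int d * \<bar>int k' - int h'\<bar> * int ((L * u + L * v) choose (L * u))
      < int L * \<bar>int k - int h\<bar> * int ((d * u + d * v) choose (d * u))"
proof (cases "u \<le> v")
  case True
  then show ?thesis using assms by (intro near_term_less_aux) auto
next
  case False
  have sym: "(a + b) choose b = (b + a) choose a" for a b :: nat
    using binomial_symmetric[of a "a + b"] by (simp add: add.commute)
  have "2 * int c * int d * \<bar>int h' - int k'\<bar> * int ((L * v + L * u) choose (L * v))
      < int L * \<bar>int h - int k\<bar> * int ((d * v + d * u) choose (d * v))"
    using assms False by (intro near_term_less_aux) auto
  then show ?thesis
    by (simp add: sym[of "L * u"] sym[of "d * u"] abs_minus_commute add.commute)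
qed

section \<open>The least order with different counts\<close>

locale order_profile =
  fixes n :: nat and P :: "nat \<Rightarrow> nat"
  assumes pos: "0 < n"
    and one: "P 1 = 1"
    and sum_le: "(\<Sum>d | d dvd n. P d) \<le> n"
    and sum_mult: "\<lbrakk>coprime a b; 0 < a; 0 < b\<rbrakk> \<Longrightarrow>
      (\<Sum>d | d dvd a * b. P d) = (\<Sum>d | d dvd a. P d) * (\<Sum>d | d dvd b. P d)"
    and prime_power_dvd: "\<lbrakk>prime q; q ^ k dvd n\<rbrakk> \<Longrightarrow> q ^ k dvd (\<Sum>d | d dvd q ^ k. P d)"
begin

text \<open>When \<open>P\<close> counts the elements of each order in a group, this is the number
  of solutions of \<open>x^e = 1\<close>.\<close>

definition K :: "nat \<Rightarrow> nat" where
  "K e = (\<Sum>d | d dvd e. P d)"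

lemma K_le: "e dvd n \<Longrightarrow> K e \<le> n"
  unfolding K_def using pos
  by (intro order_trans[OF sum_mono2 sum_le]) (auto intro: dvd_trans)

lemma K_mult: "\<lbrakk>coprime a b; 0 < a; 0 < b\<rbrakk> \<Longrightarrow> K (a * b) = K a * K b"
  unfolding K_def by (rule sum_mult)

lemma K_pos: "0 < e \<Longrightarrow> 0 < K e"
  unfolding K_def using one sum_mono2[of "{d. d dvd e}" "{1}" P] by simp

lemma K_split: "0 < d \<Longrightarrow> K d = P d + (\<Sum>c | c dvd d \<and> c \<noteq> d. P c)"
proof -
  assume "0 < d"
  then have "K d = P d + sum P ({c. c dvd d} - {d})"
    unfolding K_def by (intro sum.remove) auto
  also have "{c. c dvd d} - {d} = {c. c dvd d \<and> c \<noteq> d}" by auto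
  finally show ?thesis .
qed

text \<open>In a group, the solutions of \<open>x^e = 1\<close> and the elements with order in
  \<open>T\<close> form disjoint sets. This caps the total count at the far orders.\<close>

lemma sum_outside_le:
  assumes "e dvd n" "T \<subseteq> {d. d dvd n \<and> \<not> d dvd e}"
  shows "sum P T + K e \<le> n"
proof -
  have fin: "finite T" "finite {d. d dvd e}"
    using assms pos by (auto intro: finite_subset[of _ "{d. d dvd n}"] dvd_trans)
  have "sum P T + K e = sum P (T \<union> {d. d dvd e})"
    unfolding K_def using assms fin by (intro sum.union_disjoint[symmetric]) auto
  also have "\<dots> \<le> (\<Sum>d | d dvd n. P d)"
    using assms pos by (intro sum_mono2) (auto intro: dvd_trans)
  finally show ?thesis using sum_le by linarith
qed

end

section \<open>Arithmetic of the discrepancies below twice the least one\<close>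

locale least_discrepancy = G: order_profile n P + H: order_profile m Q
  for n P m Q +
  fixes L :: nat
  assumes L_dvd: "L dvd gcd n m" and L_ne: "P L \<noteq> Q L"
    and L_least: "\<lbrakk>d dvd gcd n m; P d \<noteq> Q d\<rbrakk> \<Longrightarrow> L \<le> d"
begin

lemma gcd_pos: "0 < gcd n m"
  using G.pos by simp

lemma L_ge_2: "2 \<le> L"
proof -
  have "L \<noteq> 0" using L_dvd gcd_pos by (metis dvd_0_left_iff less_irrefl)
  moreover have "L \<noteq> 1" using L_ne G.one H.one by metis
  ultimately show ?thesis by linarith
qed

lemma eq_below: "\<lbrakk>d dvd gcd n m; d < L\<rbrakk> \<Longrightarrow> P d = Q d"
  using L_least[of d] by linarith

text \<open>A proper divisor of \<open>d\<close> is at most half of \<open>d\<close>, hence below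
  \<open>L\<close>.\<close>

lemma proper_divisor_eq:
  assumes "d dvd gcd n m" "d < 2 * L" "c dvd d" "c \<noteq> d"
  shows "P c = Q c"
proof (rule eq_below)
  show "c dvd gcd n m" using assms dvd_trans by blast
  obtain t where t: "d = c * t" using assms by blast
  have "d \<noteq> 0" using assms gcd_pos by (metis dvd_0_left_iff less_irrefl)
  then have "t \<noteq> 0" "t \<noteq> 1" using t assms by auto
  then have "c * 2 \<le> d" unfolding t by (intro mult_le_mono2) linarith
  then show "c < L" using assms by linarith
qed

lemma K_diff:
  assumes "d dvd gcd n m" "d < 2 * L"
  shows "int (G.K d) - int (H.K d) = int (P d) - int (Q d)"
proof -
  have "0 < d" using assms gcd_pos by (metis dvd_0_left_iff gr0I less_irrefl)
  moreover have "(\<Sum>c | c dvd d \<and> c \<noteq> d. P c) = (\<Sum>c | c dvd d \<and> c \<noteq> d. Q c)"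
    using proper_divisor_eq[OF assms] by (intro sum.cong) auto
  ultimately show ?thesis
    using G.K_split[of d] H.K_split[of d] by simp
qed

text \<open>Otherwise \<open>d\<close> is a product of two coprime proper divisors. The sums
  \<open>K\<close> of both profiles agree at these, so by multiplicativity they agree at
  \<open>d\<close>, and \<open>K_diff\<close> yields \<open>P d = Q d\<close>.\<close>

lemma discrepancy_prime_power:
  assumes "d dvd gcd n m" "d < 2 * L" "P d \<noteq> Q d"
  obtains q k where "prime q" "d = q ^ k"
proof -
  have d: "L \<le> d" "d \<noteq> 0" "d \<noteq> 1" using L_least assms L_ge_2 by fastforce+
  then obtain q where q: "prime q" "q dvd d" using prime_factor_nat by blast
  then have "\<not> is_unit q" by auto
  then obtain e where e: "d = q ^ multiplicity q d * e" "\<not> q dvd e"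
    using multiplicity_decompose'[of d q] d by metis
  define a where "a = q ^ multiplicity q d"
  have "e = 1"
  proof (rule ccontr)
    assume "e \<noteq> 1"
    have "multiplicity q d > 0" using q d by (simp add: prime_multiplicity_gt_zero_iff)
    then have "a \<noteq> 1" using prime_gt_1_nat[OF q(1)] by (simp add: a_def)
    have dae: "d = a * e" using e by (simp add: a_def)
    have ae: "0 < a" "0 < e" using dae d by auto
    have "coprime a e"
      using q e by (simp add: a_def prime_imp_coprime)
    then have K: "G.K d = G.K a * G.K e" "H.K d = H.K a * H.K e"
      using ae dae by (auto intro: G.K_mult H.K_mult)
    have *: "G.K c = H.K c" if "c dvd d" "c \<noteq> d" for c
    proof -
      have "P x = Q x" if "x dvd c" for x
        using proper_divisor_eq[OF assms(1,2), of x] that \<open>c dvd d\<close> \<open>c \<noteq> d\<close>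
        by (metis dvd_antisym dvd_trans)
      then show ?thesis unfolding G.K_def H.K_def by (intro sum.cong) auto
    qed
    have "a \<noteq> d" "e \<noteq> d" using dae d \<open>a \<noteq> 1\<close> \<open>e \<noteq> 1\<close> by auto
    then have "G.K d = H.K d" using K * dae by simp
    then show False using K_diff[OF assms(1,2)] assms(3) by simp
  qed
  then show thesis using that[of q "multiplicity q d"] q e by simp
qed

text \<open>Distinct powers of the same prime differ by a factor of at least 2, but both
  discrepancies lie in the range from \<open>L\<close> to below \<open>2 * L\<close>.\<close>

lemma discrepancy_coprime:
  assumes "d dvd gcd n m" "d < 2 * L" "P d \<noteq> Q d"
    and "e dvd gcd n m" "e < 2 * L" "P e \<noteq> Q e" and "d \<noteq> e"
  shows "coprime d e"
proof (rule ccontr)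
  assume ncop: "\<not> coprime d e"
  obtain q k where q: "prime q" "d = q ^ k" using discrepancy_prime_power assms by blast
  obtain r l where r: "prime r" "e = r ^ l" using discrepancy_prime_power assms by blast
  have "q = r" using ncop q r
    by (metis coprime_power_left_iff coprime_power_right_iff primes_coprime)
  have ge: "L \<le> d" "L \<le> e" using assms L_least by auto
  have *: "2 * q ^ i \<le> q ^ j" if "i < j" for i j
  proof -
    have "2 * q ^ i \<le> q ^ Suc i" using prime_ge_2_nat[OF q(1)] by simp
    also have "\<dots> \<le> q ^ j" using that prime_ge_1_nat[OF q(1)] by (intro power_increasing) auto
    finally show ?thesis .
  qed
  have "k \<noteq> l" using assms q r \<open>q = r\<close> by auto
  then have "2 * d \<le> e \<or> 2 * e \<le> d" using *[of k l] *[of l k] q r \<open>q = r\<close> by force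
  then show False using ge assms by linarith
qed

text \<open>Together with \<open>K_diff\<close> this makes \<open>P d - Q d\<close> a nonzero
  multiple of \<open>d\<close>; in particular the leading coefficient, at \<open>L\<close>, has
  absolute value at least \<open>L\<close>.\<close>

lemma discrepancy_dvd_K:
  assumes "d dvd gcd n m" "d < 2 * L" "P d \<noteq> Q d"
  shows "d dvd G.K d" "d dvd H.K d"
proof -
  obtain q k where "prime q" "d = q ^ k" using discrepancy_prime_power assms by blast
  then show "d dvd G.K d" "d dvd H.K d"
    using assms(1) G.prime_power_dvd[of q k] H.prime_power_dvd[of q k]
    by (auto simp: G.K_def H.K_def)
qed

section \<open>Domination of all other terms by the one at the least discrepancy\<close>

theorem weighted_sum_ne:
  "(\<Sum>d | d dvd gcd n m. int (P d) * int ((n div d + m div d) choose (n div d)))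
    \<noteq> (\<Sum>d | d dvd gcd n m. int (Q d) * int ((n div d + m div d) choose (n div d)))"
proof
  define f where "f d = int ((n div d + m div d) choose (n div d))" for d
  define D where "D d = int (P d) - int (Q d)" for d
  assume "(\<Sum>d | d dvd gcd n m. int (P d) * int ((n div d + m div d) choose (n div d)))
    = (\<Sum>d | d dvd gcd n m. int (Q d) * int ((n div d + m div d) choose (n div d)))"
  then have zero: "(\<Sum>d | d dvd gcd n m. D d * f d) = 0"
    by (simp add: D_def f_def left_diff_distrib sum_subtractf)
  have fin: "finite {d. d dvd gcd n m}" using gcd_pos by (rule finite_divisors_nat)
  \<comment> \<open>The far and the near discrepancies. Besides \<open>L\<close> itself only these
    contribute to the difference of the sums.\<close>
  define T where "T = {d. d dvd gcd n m \<and> P d \<noteq> Q d \<and> 2 * L \<le> d}"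
  define W where "W = {d. d dvd gcd n m \<and> P d \<noteq> Q d \<and> L < d \<and> d < 2 * L}"
  have finTW: "finite T" "finite W"
    by (auto simp: T_def W_def intro: finite_subset[OF _ fin])
  have f_nonneg: "0 \<le> f d" for d by (simp add: f_def)
  have fL: "0 < f L" by (simp add: f_def)
  have "(\<Sum>d | d dvd gcd n m. D d * f d) = (\<Sum>d\<in>insert L (T \<union> W). D d * f d)"
  proof (rule sum.mono_neutral_right[OF fin])
    show "insert L (T \<union> W) \<subseteq> {d. d dvd gcd n m}" using L_dvd by (auto simp: T_def W_def)
    show "\<forall>d\<in>{d. d dvd gcd n m} - insert L (T \<union> W). D d * f d = 0"
    proof
      fix d assume d: "d \<in> {d. d dvd gcd n m} - insert L (T \<union> W)"
      have "P d = Q d"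
      proof (rule ccontr)
        assume "P d \<noteq> Q d"
        then have "L \<le> d" using L_least[of d] d by simp
        then show False using d \<open>P d \<noteq> Q d\<close> by (auto simp: T_def W_def)
      qed
      then show "D d * f d = 0" by (simp add: D_def)
    qed
  qed
  also have "\<dots> = D L * f L + (\<Sum>d\<in>T. D d * f d) + (\<Sum>d\<in>W. D d * f d)"
  proof -
    have "L \<notin> T \<union> W" "T \<inter> W = {}" using L_ge_2 by (auto simp: T_def W_def)
    then show ?thesis using finTW by (simp add: sum.union_disjoint)
  qed
  finally have "\<bar>D L * f L\<bar> \<le> \<bar>\<Sum>d\<in>T. D d * f d\<bar> + \<bar>\<Sum>d\<in>W. D d * f d\<bar>"
    using zero by linarith
  also have "\<dots> \<le> (\<Sum>d\<in>T. \<bar>D d\<bar> * f d) + (\<Sum>d\<in>W. \<bar>D d\<bar> * f d)"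
    by (intro add_mono order_trans[OF sum_abs]) (auto simp: abs_mult f_nonneg intro!: sum_mono)
  finally have main: "\<bar>D L\<bar> * f L \<le> (\<Sum>d\<in>T. \<bar>D d\<bar> * f d) + (\<Sum>d\<in>W. \<bar>D d\<bar> * f d)"
    using fL by (simp add: abs_mult)

  define A B where "A = n div L" and "B = m div L"
  have n: "n = L * A" and m: "m = L * B" using L_dvd by (auto simp: A_def B_def)
  have "L < 2 * L" using L_ge_2 by simp
  note L_bad = L_dvd \<open>L < 2 * L\<close> L_ne
  obtain k h where k: "G.K L = L * k" and h: "H.K L = L * h"
    using discrepancy_dvd_K[OF L_bad] by blast
  have "0 < G.K L" "0 < H.K L" using L_ge_2 by (auto intro: G.K_pos H.K_pos)
  then have kh_pos: "0 < k" "0 < h" using k h by auto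
  have DL: "D L = int L * (int k - int h)"
    using K_diff[OF L_bad(1,2)] k h by (simp add: D_def right_diff_distrib)
  then have kh: "k \<noteq> h" using L_ne by (auto simp: D_def)
  then have "1 \<le> \<bar>int k - int h\<bar>" by simp
  then have "int L * 1 \<le> int L * \<bar>int k - int h\<bar>" by (intro mult_left_mono) auto
  then have DL_ge: "int L \<le> \<bar>D L\<bar>" by (simp add: DL abs_mult)
  have DLf: "int L * f L \<le> \<bar>D L\<bar> * f L" using DL_ge fL by (intro mult_right_mono) auto
  have "L * k \<le> L * A" "L * h \<le> L * B"
    using G.K_le[of L] H.K_le[of L] L_dvd k h n m by auto
  then have AB: "3 \<le> A + B" using kh kh_pos L_ge_2 by auto

  have "\<not> d dvd L" if "d \<in> T" for d
    using that L_ge_2 by (auto simp: T_def dest: dvd_imp_le)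
  then have "T \<subseteq> {d. d dvd n \<and> \<not> d dvd L}" "T \<subseteq> {d. d dvd m \<and> \<not> d dvd L}"
    by (auto simp: T_def)
  then have "sum P T + L * k \<le> L * A" "sum Q T + L * h \<le> L * B"
    using G.sum_outside_le[of L T] H.sum_outside_le[of L T] L_dvd k h n m by simp_all
  then have "sum P T + sum Q T + L * (k + h) \<le> L * (A + B)"
    by (simp add: algebra_simps)
  \<comment> \<open>Two distinct positive numbers sum to at least 3. This 3 puts the cap
    \<open>A + B - 3\<close> on the far terms just below the gain \<open>A + B - 2\<close> of
    \<open>binomial_double_le\<close>.\<close>
  moreover have "L * 3 \<le> L * (k + h)" using kh kh_pos by (intro mult_le_mono2) linarith
  ultimately have PQ: "sum P T + sum Q T + L * 3 \<le> L * (A + B)" by linarith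
  have "(\<Sum>d\<in>T. \<bar>D d\<bar>) \<le> (\<Sum>d\<in>T. int (P d) + int (Q d))"
    by (intro sum_mono) (auto simp: D_def)
  also have "\<dots> = int (sum P T + sum Q T)" by (simp add: sum.distrib)
  also have "\<dots> \<le> int (L * (A + B)) - int (L * 3)" using PQ by linarith
  also have "\<dots> = int L * int (A + B - 3)" using AB by (simp add: of_nat_diff algebra_simps)
  finally have sumT: "(\<Sum>d\<in>T. \<bar>D d\<bar>) \<le> int L * int (A + B - 3)" .
  \<comment> \<open>The factor \<open>c\<close> is the decay of the far weights:
    \<open>A + B - 2\<close> if there are no near discrepancies, \<open>2 * (A + B - 3)\<close>
    otherwise.\<close>
  have far: "c * (\<Sum>d\<in>T. \<bar>D d\<bar> * f d) \<le> int L * int (A + B - 3) * f L"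
    if "\<And>d. d \<in> T \<Longrightarrow> c * f d \<le> f L" for c
  proof -
    have "c * (\<Sum>d\<in>T. \<bar>D d\<bar> * f d) = (\<Sum>d\<in>T. \<bar>D d\<bar> * (c * f d))"
      by (simp add: sum_distrib_left mult_ac)
    also have "\<dots> \<le> (\<Sum>d\<in>T. \<bar>D d\<bar> * f L)"
      using that by (intro sum_mono mult_left_mono) auto
    also have "\<dots> = (\<Sum>d\<in>T. \<bar>D d\<bar>) * f L" by (simp add: sum_distrib_right)
    also have "\<dots> \<le> int L * int (A + B - 3) * f L"
      using sumT fL by (intro mult_right_mono) auto
    finally show ?thesis .
  qed
  have halves: "0 < n div d" "0 < m div d" "2 * (n div d) \<le> A" "2 * (m div d) \<le> B" if "d \<in> T" for d
  proof -
    have d: "d dvd n" "d dvd m" "2 * L \<le> d" "0 < d" using that L_ge_2 by (auto simp: T_def)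
    then show "0 < n div d" "0 < m div d"
      using G.pos H.pos by (auto simp: dvd_imp_le div_greater_zero_iff)
    have "L * (2 * (n div d)) \<le> d * (n div d)" "L * (2 * (m div d)) \<le> d * (m div d)"
      using mult_le_mono1[OF d(3), of "n div d"] mult_le_mono1[OF d(3), of "m div d"]
      by (simp_all only: mult_ac)
    then have "L * (2 * (n div d)) \<le> L * A" "L * (2 * (m div d)) \<le> L * B"
      unfolding n[symmetric] m[symmetric] using d by simp_all
    then show "2 * (n div d) \<le> A" "2 * (m div d) \<le> B" using L_ge_2 by simp_all
  qed

  show False
  proof (cases "W = {}")
    case True
    have "int (A + B - 2) * f d \<le> f L" if "d \<in> T" for d
    proof -
      have "(A + B - 2) * ((n div d + m div d) choose (n div d)) \<le> (A + B) choose A"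
        using halves[OF that] by (intro binomial_double_le)
      then have "int ((A + B - 2) * ((n div d + m div d) choose (n div d))) \<le> int ((A + B) choose A)"
        by (simp only: of_nat_le_iff)
      then show ?thesis by (simp only: f_def A_def B_def of_nat_mult)
    qed
    then have "int (A + B - 2) * (\<Sum>d\<in>T. \<bar>D d\<bar> * f d) \<le> int L * int (A + B - 3) * f L"
      by (rule far)
    moreover have "int L * f L \<le> (\<Sum>d\<in>T. \<bar>D d\<bar> * f d)"
      using main DLf True by simp
    then have "int (A + B - 2) * (int L * f L) \<le> int (A + B - 2) * (\<Sum>d\<in>T. \<bar>D d\<bar> * f d)"
      by (intro mult_left_mono) auto
    ultimately have "int (A + B - 2) * (int L * f L) \<le> int (A + B - 3) * (int L * f L)"
      by (simp add: mult_ac)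
    moreover have "0 < int L * f L" using fL L_ge_2 by simp
    ultimately have "int (A + B - 2) \<le> int (A + B - 3)"
      by (rule mult_right_le_imp_le)
    then show False using AB by simp
  next
    case False
    \<comment> \<open>Each near term stays below the leading term divided by
      \<open>2 * card W\<close>, so that together they take less than half of it. The second
      conjunct is the side condition of \<open>binomial_double_le'\<close>.\<close>
    have near: "2 * int (card W) * (\<bar>D d\<bar> * f d) < \<bar>D L\<bar> * f L \<and>
        ((6 \<le> A \<and> 6 \<le> B) \<or> (3 \<le> A \<and> 12 \<le> B) \<or> (12 \<le> A \<and> 3 \<le> B))"
      if dW: "d \<in> W" for d
    proof -
      have d: "d dvd gcd n m" "d < 2 * L" "P d \<noteq> Q d" "L < d" "0 < d"
        using dW by (auto simp: W_def)
      note d_bad = d(1-3)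
      have cop: "coprime L d" using discrepancy_coprime[OF L_bad d_bad] d by simp
      then have Ld: "L * d dvd gcd n m" using d L_dvd by (simp add: divides_mult)
      define u v where "u = n div (L * d)" and "v = m div (L * d)"
      have nu: "n = L * d * u" and mv: "m = L * d * v" using Ld by (auto simp: u_def v_def)
      have uv: "0 < u" "0 < v" using nu mv G.pos H.pos by (auto intro: gr0I)
      obtain k' h' where k': "G.K d = d * k'" and h': "H.K d = d * h'"
        using discrepancy_dvd_K[OF d_bad] by blast
      have "0 < G.K d" "0 < H.K d" using d by (auto intro: G.K_pos H.K_pos)
      then have k'h'_pos: "0 < k'" "0 < h'" using k' h' by auto
      have Dd: "D d = int d * (int k' - int h')"
        using K_diff[OF d_bad(1,2)] k' h' by (simp add: D_def right_diff_distrib)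
      then have k'h': "k' \<noteq> h'" using d by (auto simp: D_def)
      \<comment> \<open>As \<open>L\<close> and \<open>d\<close> are coprime, the left sides are the
        values of \<open>K\<close> at \<open>L * d\<close>, which cannot exceed \<open>n\<close> and
        \<open>m\<close>.\<close>
      have "L * k * (d * k') \<le> n" "L * h * (d * h') \<le> m"
        using G.K_mult[OF cop] H.K_mult[OF cop] G.K_le[of "L * d"] H.K_le[of "L * d"] Ld d L_ge_2
          k h k' h' by auto
      then have "L * d * (k * k') \<le> L * d * u" "L * d * (h * h') \<le> L * d * v"
        using nu mv by (simp_all add: mult_ac)
      then have kku: "k * k' \<le> u" "h * h' \<le> v" using d L_ge_2 by simp_all
      have "2 \<le> L" by (rule L_ge_2)
      have c: "card W \<le> 1 \<or> card W \<le> L \<and> L \<le> u \<and> L \<le> v \<and> 4 \<le> u \<and> 4 \<le> v"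
      proof (cases "card W \<le> 1")
        \<comment> \<open>A second near discrepancy \<open>e\<close> is coprime to \<open>L\<close>
          and \<open>d\<close>, so it divides \<open>u\<close> and \<open>v\<close> and forces both
          to exceed \<open>L\<close>. As \<open>card W\<close> is at least 2 and at most
          \<open>L - 1\<close>, also \<open>L \<ge> 3\<close> and hence
          \<open>e \<ge> 4\<close>.\<close>
        case False
        have "\<not> W \<subseteq> {d}" using False card_mono[of "{d}" W] by auto
        then obtain e where eW: "e \<in> W" "e \<noteq> d" by auto
        then have e: "e dvd gcd n m" "e < 2 * L" "P e \<noteq> Q e" "L < e" by (auto simp: W_def)
        have "coprime L e" using discrepancy_coprime[OF L_bad e(1-3)] e by simp
        moreover have "coprime d e" using discrepancy_coprime[OF d_bad e(1-3)] eW by simp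
        ultimately have "L * d * e dvd gcd n m" using Ld e by (simp add: divides_mult)
        then have "L * d * e dvd L * d * u" "L * d * e dvd L * d * v" using nu mv by auto
        then have "e dvd u" "e dvd v" using d L_ge_2 by auto
        then have "e \<le> u" "e \<le> v" using uv by (auto dest: dvd_imp_le)
        moreover have "card W \<le> card {L<..<2 * L}"
          by (intro card_mono) (auto simp: W_def)
        then have "card W \<le> L - 1" by simp
        ultimately show ?thesis using e False by linarith
      qed simp
      have four: "4 \<le> w" if "a * b \<le> w" "a \<noteq> 1" "b \<noteq> 1" "0 < a" "0 < b" for a b w :: nat
      proof -
        have "2 * 2 \<le> a * b" using that by (intro mult_le_mono) auto
        then show ?thesis using that by simp
      qed
      have "2 * int (card W) * int d * \<bar>int k' - int h'\<bar> * int ((L * u + L * v) choose (L * u))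
          < int L * \<bar>int k - int h\<bar> * int ((d * u + d * v) choose (d * u))"
        using L_ge_2 d uv kh_pos k'h'_pos kku kh k'h' c by (intro near_term_less)
      moreover have "n div d = L * u" "m div d = L * v" "n div L = d * u" "m div L = d * v"
        using nu mv d L_ge_2 by simp_all
      ultimately have "2 * int (card W) * (\<bar>D d\<bar> * f d) < \<bar>D L\<bar> * f L"
        by (simp add: f_def Dd DL abs_mult mult_ac)
      moreover have "A = d * u" "B = d * v" using nu mv L_ge_2 by (simp_all add: A_def B_def)
      \<comment> \<open>If \<open>u = 1\<close>, then \<open>k = k' = 1\<close>, so \<open>h\<close>
        and \<open>h'\<close> are at least 2 and \<open>v\<close> is at least 4; symmetrically for
        \<open>v = 1\<close>. The numbers 3, 6 and 12 then come from
        \<open>d \<ge> 3\<close>.\<close>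
      moreover have "(6 \<le> d * u \<and> 6 \<le> d * v) \<or> (3 \<le> d * u \<and> 12 \<le> d * v) \<or> (12 \<le> d * u \<and> 3 \<le> d * v)"
      proof -
        have d3: "3 \<le> d" using d L_ge_2 by simp
        have mono: "a * b \<le> d * w" if "a \<le> d" "b \<le> w" for a b w using that by (rule mult_le_mono)
        have unit: "a = 1 \<and> b = 1" if "a * b \<le> 1" "0 < a" "0 < b" for a b :: nat
          using that by (metis One_nat_def Suc_leI le_antisym mult_eq_1_iff nat_0_less_mult_iff)
        consider "u = 1" | "v = 1" | "2 \<le> u" "2 \<le> v" using uv by linarith
        then show ?thesis
        proof cases
          case 1
          then have "k = 1 \<and> k' = 1" using unit kku kh_pos k'h'_pos by simp
          then have "4 \<le> v" using four[of h h' v] kku kh k'h' kh_pos k'h'_pos by auto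
          then show ?thesis using mono[of 3 4 v] mono[of 3 1 u] d3 1 by simp
        next
          case 2
          then have "h = 1 \<and> h' = 1" using unit kku kh_pos k'h'_pos by simp
          then have "4 \<le> u" using four[of k k' u] kku kh k'h' kh_pos k'h'_pos by auto
          then show ?thesis using mono[of 3 4 u] mono[of 3 1 v] d3 2 by simp
        next
          case 3
          then show ?thesis using mono[of 3 2 u] mono[of 3 2 v] d3 by simp
        qed
      qed
      ultimately show ?thesis by simp
    qed
    obtain d0 where d0: "d0 \<in> W" using False by blast
    note large = conjunct2[OF near[OF d0]]
    have "2 * int (A + B - 3) * f d \<le> f L" if "d \<in> T" for d
    proof -
      have "2 * (A + B - 3) * ((n div d + m div d) choose (n div d)) \<le> (A + B) choose A"
        using halves[OF that] large by (intro binomial_double_le')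
      then have "int (2 * (A + B - 3) * ((n div d + m div d) choose (n div d))) \<le> int ((A + B) choose A)"
        by (simp only: of_nat_le_iff)
      then show ?thesis by (simp only: f_def A_def B_def of_nat_mult of_nat_numeral)
    qed
    then have "2 * int (A + B - 3) * (\<Sum>d\<in>T. \<bar>D d\<bar> * f d) \<le> int L * int (A + B - 3) * f L"
      by (rule far)
    then have "int (A + B - 3) * (2 * (\<Sum>d\<in>T. \<bar>D d\<bar> * f d)) \<le> int (A + B - 3) * (int L * f L)"
      by (simp add: mult_ac)
    moreover have "0 < int (A + B - 3)" using large by auto
    ultimately have halfT: "2 * (\<Sum>d\<in>T. \<bar>D d\<bar> * f d) \<le> int L * f L" by simp
    have "2 * int (card W) * (\<Sum>d\<in>W. \<bar>D d\<bar> * f d) = (\<Sum>d\<in>W. 2 * int (card W) * (\<bar>D d\<bar> * f d))"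
      by (rule sum_distrib_left)
    also have "\<dots> < (\<Sum>d\<in>W. \<bar>D L\<bar> * f L)"
      using near finTW False by (intro sum_strict_mono) auto
    also have "\<dots> = int (card W) * (\<bar>D L\<bar> * f L)" by simp
    finally have "int (card W) * (2 * (\<Sum>d\<in>W. \<bar>D d\<bar> * f d)) < int (card W) * (\<bar>D L\<bar> * f L)"
      by (simp add: mult_ac)
    then have "2 * (\<Sum>d\<in>W. \<bar>D d\<bar> * f d) < \<bar>D L\<bar> * f L"
      by (simp add: mult_less_cancel_left)
    then show False using main halfT DLf by linarith
  qed
qed

end

section \<open>Sequences with a prescribed sum\<close>

text \<open>The product is an arbitrary \<open>h\<close> because the recursion removes copies of an
  element and thereby leaves the zero-sum sequences.\<close>

definition fixed_sum_seqs :: "('a, 'b) monoid_scheme \<Rightarrow> nat \<Rightarrow> 'a \<Rightarrow> 'a multiset set" where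
  "fixed_sum_seqs G m h =
     {M. set_mset M \<subseteq> carrier G \<and> size M = m \<and> seq_sum G M = h}"

definition roots_of :: "('a, 'b) monoid_scheme \<Rightarrow> nat \<Rightarrow> 'a \<Rightarrow> 'a set" where
  "roots_of G e h = {z \<in> carrier G. z [^]\<^bsub>G\<^esub> e = h}"

context comm_group
begin

lemma finite_fixed_sum_seqs:
  assumes "finite (carrier G)"
  shows "finite (fixed_sum_seqs G m h)"
  by (rule finite_subset[OF _ finite_multisets_of_size[OF assms, of m]])
    (auto simp: fixed_sum_seqs_def multisets_of_size_def)

lemma seq_sum_closed: "set_mset M \<subseteq> carrier G \<Longrightarrow> seq_sum G M \<in> carrier G"
  by (induction M) (auto simp: seq_sum_empty seq_sum_add_mset)

lemma seq_sum_add_replicate: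
  assumes "g \<in> carrier G" "set_mset M \<subseteq> carrier G"
  shows "seq_sum G (M + replicate_mset k g) = g [^] k \<otimes> seq_sum G M"
proof (induction k)
  case 0
  then show ?case using assms by (simp add: seq_sum_closed)
next
  case (Suc k)
  have "set_mset (M + replicate_mset k g) \<subseteq> carrier G"
    using assms by (auto simp: in_replicate_mset)
  then have "seq_sum G (add_mset g (M + replicate_mset k g)) = g \<otimes> (g [^] k \<otimes> seq_sum G M)"
    using assms Suc by (simp add: seq_sum_add_mset)
  also have "\<dots> = g [^] Suc k \<otimes> seq_sum G M"
    using assms by (simp add: seq_sum_closed m_assoc m_comm m_lcomm)
  finally show ?case by simp
qed

text \<open>Adding \<open>k\<close> copies of \<open>g\<close> and removing them again are mutually
  inverse.\<close>

lemma card_fixed_sum_seqs_count_ge: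
  assumes g: "g \<in> carrier G" and h: "h \<in> carrier G" and k: "k \<le> m"
  shows "card {M \<in> fixed_sum_seqs G m h. k \<le> count M g}
    = card (fixed_sum_seqs G (m - k) (h \<otimes> inv (g [^] k)))"
proof (rule bij_betw_same_card[symmetric])
  have eq: "seq_sum G (M + replicate_mset k g) = h \<longleftrightarrow> seq_sum G M = h \<otimes> inv (g [^] k)"
    if "set_mset M \<subseteq> carrier G" for M
  proof -
    have "seq_sum G (M + replicate_mset k g) = seq_sum G M \<otimes> g [^] k"
      using g that by (simp add: seq_sum_add_replicate seq_sum_closed m_comm)
    then show ?thesis
      using g h that by (metis inv_solve_right' nat_pow_closed seq_sum_closed)
  qed
  show "bij_betw (\<lambda>M. M + replicate_mset k g) (fixed_sum_seqs G (m - k) (h \<otimes> inv (g [^] k)))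
      {M \<in> fixed_sum_seqs G m h. k \<le> count M g}"
  proof (rule bij_betw_byWitness[where f' = "\<lambda>M. M - replicate_mset k g"])
    show "\<forall>M\<in>{M \<in> fixed_sum_seqs G m h. k \<le> count M g}.
        M - replicate_mset k g + replicate_mset k g = M"
      by (auto simp: count_le_replicate_mset_subset_eq)
    show "(\<lambda>M. M + replicate_mset k g) ` fixed_sum_seqs G (m - k) (h \<otimes> inv (g [^] k))
        \<subseteq> {M \<in> fixed_sum_seqs G m h. k \<le> count M g}"
    proof clarify
      fix M assume M: "M \<in> fixed_sum_seqs G (m - k) (h \<otimes> inv (g [^] k))"
      then have "set_mset (M + replicate_mset k g) \<subseteq> carrier G"
        using g by (auto simp: fixed_sum_seqs_def in_replicate_mset)
      then show "M + replicate_mset k g \<in> fixed_sum_seqs G m h \<and> k \<le> count (M + replicate_mset k g) g"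
        using M k eq[of M] by (simp add: fixed_sum_seqs_def)
    qed
    show "(\<lambda>M. M - replicate_mset k g) ` {M \<in> fixed_sum_seqs G m h. k \<le> count M g}
        \<subseteq> fixed_sum_seqs G (m - k) (h \<otimes> inv (g [^] k))"
    proof clarify
      fix M assume M: "M \<in> fixed_sum_seqs G m h" and "k \<le> count M g"
      then have sub: "replicate_mset k g \<subseteq># M"
        by (simp add: count_le_replicate_mset_subset_eq)
      moreover have "set_mset (M - replicate_mset k g) \<subseteq> carrier G"
        using M by (auto simp: fixed_sum_seqs_def dest: in_diffD)
      ultimately show "M - replicate_mset k g \<in> fixed_sum_seqs G (m - k) (h \<otimes> inv (g [^] k))"
        using M eq[of "M - replicate_mset k g"]
        by (auto simp: fixed_sum_seqs_def size_Diff_submset)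
    qed
  qed simp
qed

text \<open>Newton's identity: both sides count the triples \<open>(M, g, k)\<close> with
  \<open>1 \<le> k \<le> count M g\<close>.\<close>

lemma newton_fixed_sum_seqs:
  assumes fin: "finite (carrier G)" and h: "h \<in> carrier G"
  shows "m * card (fixed_sum_seqs G m h)
    = (\<Sum>k=1..m. \<Sum>g\<in>carrier G. card (fixed_sum_seqs G (m - k) (h \<otimes> inv (g [^] k))))"
proof -
  let ?S = "fixed_sum_seqs G m h"
  have finS: "finite ?S" using fin by (rule finite_fixed_sum_seqs)
  have "m * card ?S = (\<Sum>M\<in>?S. size M)"
    by (simp add: fixed_sum_seqs_def)
  also have "\<dots> = (\<Sum>M\<in>?S. \<Sum>g\<in>carrier G. count M g)"
  proof (rule sum.cong[OF refl])
    fix M assume "M \<in> ?S"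
    then have "set_mset M \<subseteq> carrier G" by (simp add: fixed_sum_seqs_def)
    then show "size M = (\<Sum>g\<in>carrier G. count M g)"
      unfolding size_multiset_overloaded_eq using fin
      by (intro sum.mono_neutral_left) (auto simp: not_in_iff)
  qed
  also have "\<dots> = (\<Sum>M\<in>?S. \<Sum>g\<in>carrier G. \<Sum>k=1..m. of_bool (k \<le> count M g))"
  proof (intro sum.cong refl)
    fix M g assume "M \<in> ?S"
    then have "count M g \<le> m" using count_le_size[of M g] by (simp add: fixed_sum_seqs_def)
    then have eq: "{1..m} \<inter> {k. k \<le> count M g} = {1..count M g}" by auto
    have "(\<Sum>k=1..m. of_bool (k \<le> count M g)) = card ({1..m} \<inter> {k. k \<le> count M g})"
      by (simp add: sum_of_bool_eq)
    then show "count M g = (\<Sum>k=1..m. of_bool (k \<le> count M g))"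
      unfolding eq by simp
  qed
  also have "\<dots> = (\<Sum>g\<in>carrier G. \<Sum>M\<in>?S. \<Sum>k=1..m. of_bool (k \<le> count M g))"
    by (rule sum.swap)
  also have "\<dots> = (\<Sum>g\<in>carrier G. \<Sum>k=1..m. \<Sum>M\<in>?S. of_bool (k \<le> count M g))"
    by (intro sum.cong refl sum.swap)
  also have "\<dots> = (\<Sum>k=1..m. \<Sum>g\<in>carrier G. \<Sum>M\<in>?S. of_bool (k \<le> count M g))"
    by (rule sum.swap)
  also have "\<dots> = (\<Sum>k=1..m. \<Sum>g\<in>carrier G. card (fixed_sum_seqs G (m - k) (h \<otimes> inv (g [^] k))))"
  proof (intro sum.cong refl)
    fix k g assume "k \<in> {1..m}" "g \<in> carrier G"
    then have "card {M \<in> ?S. k \<le> count M g} = card (fixed_sum_seqs G (m - k) (h \<otimes> inv (g [^] k)))"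
      using h by (intro card_fixed_sum_seqs_count_ge) auto
    moreover have "(\<Sum>M\<in>?S. of_bool (k \<le> count M g)) = card (?S \<inter> {M. k \<le> count M g})"
      using finS by (simp add: sum_of_bool_eq)
    ultimately show "(\<Sum>M\<in>?S. of_bool (k \<le> count M g))
        = card (fixed_sum_seqs G (m - k) (h \<otimes> inv (g [^] k)))"
      by (simp add: Int_def)
  qed
  finally show ?thesis .
qed

text \<open>Euclid's algorithm: \<open>x\<^sup>k y\<^sup>e\<close> becomes \<open>x\<^bsup>k mod e\<^esup> (x\<^bsup>k div e\<^esup> y)\<^sup>e\<close>
  under a bijective substitution.\<close>

lemma card_pow_mult_pow_eq:
  "card {(x, y). x \<in> carrier G \<and> y \<in> carrier G \<and> x [^] (k::nat) \<otimes> y [^] (e::nat) = h}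
    = order G * card (roots_of G (gcd k e) h)"
proof (induction k e rule: gcd_nat_induct)
  case (base k)
  have "{(x, y). x \<in> carrier G \<and> y \<in> carrier G \<and> x [^] k \<otimes> y [^] (0::nat) = h}
      = roots_of G k h \<times> carrier G"
    by (auto simp: roots_of_def)
  then show ?case by (simp add: card_cartesian_product order_def mult.commute)
next
  case (step k e)
  let ?A = "\<lambda>k e. {(x, y). x \<in> carrier G \<and> y \<in> carrier G \<and> x [^] (k::nat) \<otimes> y [^] (e::nat) = h}"
  have id: "x [^] k \<otimes> y [^] e = (x [^] (k div e) \<otimes> y) [^] e \<otimes> x [^] (k mod e)"
    if "x \<in> carrier G" "y \<in> carrier G" for x y
  proof -
    have "x [^] k = x [^] (k div e * e + k mod e)" by simp
    also have "\<dots> = (x [^] (k div e)) [^] e \<otimes> x [^] (k mod e)"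
      using that by (simp only: nat_pow_mult nat_pow_pow)
    finally show ?thesis using that by (simp add: nat_pow_distrib m_ac)
  qed
  have "bij_betw (\<lambda>(x, y). (x [^] (k div e) \<otimes> y, x)) (?A k e) (?A e (k mod e))"
  proof (rule bij_betw_byWitness[where f' = "\<lambda>(z, x). (x, inv (x [^] (k div e)) \<otimes> z)"])
    show "\<forall>p\<in>?A k e. (\<lambda>(z, x). (x, inv (x [^] (k div e)) \<otimes> z))
        ((\<lambda>(x, y). (x [^] (k div e) \<otimes> y, x)) p) = p"
      by (auto simp: m_assoc[symmetric])
    show "\<forall>p\<in>?A e (k mod e). (\<lambda>(x, y). (x [^] (k div e) \<otimes> y, x))
        ((\<lambda>(z, x). (x, inv (x [^] (k div e)) \<otimes> z)) p) = p"
      by (auto simp: m_assoc[symmetric])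
    show "(\<lambda>(x, y). (x [^] (k div e) \<otimes> y, x)) ` ?A k e \<subseteq> ?A e (k mod e)"
      using id by auto
    show "(\<lambda>(z, x). (x, inv (x [^] (k div e)) \<otimes> z)) ` ?A e (k mod e) \<subseteq> ?A k e"
    proof clarsimp
      fix x z assume "x \<in> carrier G" "z \<in> carrier G"
      then show "x [^] k \<otimes> (inv (x [^] (k div e)) \<otimes> z) [^] e = z [^] e \<otimes> x [^] (k mod e)"
        using id[of x "inv (x [^] (k div e)) \<otimes> z"] by (simp add: m_assoc[symmetric])
    qed
  qed
  then have "card (?A k e) = card (?A e (k mod e))" by (rule bij_betw_same_card)
  then show ?case using step by (simp add: gcd_red_nat[of k e])
qed

text \<open>Both sides count the pairs with \<open>g^k z^e = h\<close>. Root counts are thus closed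
  under the summation over \<open>g\<close> in Newton's identity, with \<open>e\<close> replaced by
  \<open>gcd k e\<close>.\<close>

lemma sum_card_roots_of:
  assumes "finite (carrier G)" "h \<in> carrier G"
  shows "(\<Sum>g\<in>carrier G. card (roots_of G e (h \<otimes> inv (g [^] k))))
    = order G * card (roots_of G (gcd k e) h)"
proof -
  have "(\<Sum>g\<in>carrier G. card (roots_of G e (h \<otimes> inv (g [^] k))))
      = card (SIGMA g:carrier G. roots_of G e (h \<otimes> inv (g [^] k)))"
    using assms by (intro card_SigmaI[symmetric]) (auto simp: roots_of_def)
  also have "(SIGMA g:carrier G. roots_of G e (h \<otimes> inv (g [^] k)))
      = {(x, y). x \<in> carrier G \<and> y \<in> carrier G \<and> x [^] k \<otimes> y [^] e = h}"
  proof -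
    have "y [^] e = h \<otimes> inv (x [^] k) \<longleftrightarrow> x [^] k \<otimes> y [^] e = h"
      if "x \<in> carrier G" "y \<in> carrier G" for x y
      using that assms by (metis inv_solve_right' m_comm nat_pow_closed)
    then show ?thesis by (auto simp: roots_of_def)
  qed
  finally show ?thesis by (simp add: card_pow_mult_pow_eq)
qed

end

section \<open>Expansion of the sequence counts in root counts\<close>

text \<open>This is Newton's identity for the complete symmetric polynomials in \<open>r\<close>
  variables, all set to 1: the binomials count multisets of size \<open>j\<close> over
  \<open>r\<close> elements, and every power sum equals \<open>r\<close>.\<close>

lemma sum_binomial_lower:
  fixes r s :: nat
  assumes "0 < r" "0 < s"
  shows "r * (\<Sum>j<s. (r + j - 1) choose j) = s * ((r + s - 1) choose s)"
proof -
  obtain r' s' where r: "r = Suc r'" "s = Suc s'" using assms gr0_implies_Suc by metis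
  have "(\<Sum>j<s. (r + j - 1) choose j) = (\<Sum>j\<le>s'. (r' + j) choose j)"
    by (simp add: r lessThan_Suc_atMost)
  also have "\<dots> = Suc (r' + s') choose s'" by (rule sum_choose_lower)
  finally show ?thesis
    using Suc_times_binomial_add[of s' r'] by (simp add: r add.commute)
qed

context comm_group
begin

text \<open>Newton's identity allows induction on \<open>m\<close>. The second conjunct prepares the
  evaluation at \<open>h = \<one>\<close>, where an element of order \<open>d\<close> contributes
  the \<open>b e\<close> with \<open>d dvd e\<close>. Its value is the coefficient of
  \<open>t^m\<close> in \<open>(1 - t^d)^(-n/d)\<close>, divided by \<open>n\<close>, where
  \<open>n\<close> is the order of the group.\<close>

lemma fixed_sum_seqs_expansion:
  assumes fin: "finite (carrier G)"
  shows "\<exists>b. (\<forall>h\<in>carrier G. real (card (fixed_sum_seqs G m h))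
        = (\<Sum>e\<le>m. b e * real (card (roots_of G e h)))) \<and>
      (\<forall>d. 0 < d \<longrightarrow> d dvd order G \<longrightarrow> (\<Sum>e\<le>m. b e * of_bool (d dvd e))
        = (if d dvd m
           then real ((order G div d + m div d - 1) choose (m div d)) / real (order G) else 0))"
    (is "\<exists>b. ?P m b")
proof (induction m rule: less_induct)
  case (less m)
  define n where "n = real (order G)"
  have n: "n > 0" using fin by (simp add: n_def order_gt_0_iff_finite)
  show ?case
  proof (cases "m = 0")
    case True
    \<comment> \<open>The index 0 is essential: \<open>roots_of G 0 h\<close> is the whole group or
      empty, so \<open>1 / n\<close> times its size tells whether \<open>h\<close> is neutral. Being
      divisible by every \<open>d\<close>, this index also gives the second conjunct at
      \<open>m = 0\<close>.\<close>
    have "real (card (fixed_sum_seqs G 0 h)) = 1 / n * real (card (roots_of G 0 h))"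
      if "h \<in> carrier G" for h
    proof -
      have "fixed_sum_seqs G 0 h = (if h = \<one> then {{#}} else {})"
        by (auto simp: fixed_sum_seqs_def seq_sum_empty)
      moreover have "roots_of G 0 h = (if h = \<one> then carrier G else {})"
        by (auto simp: roots_of_def)
      ultimately show ?thesis using n by (simp add: n_def order_def)
    qed
    then have "?P m (\<lambda>_. 1 / n)" using True by (simp add: n_def)
    then show ?thesis by (intro exI[of _ "\<lambda>_. 1 / n"])
  next
    case False
    have "\<forall>j. \<exists>b. j < m \<longrightarrow> ?P j b" using less.IH by (simp only: ex_simps) simp
    then have "\<exists>B. \<forall>j. j < m \<longrightarrow> ?P j (B j)" by (rule choice)
    then obtain B where B0: "\<forall>j. j < m \<longrightarrow> ?P j (B j)" by (rule exE)
    have B: "?P j (B j)" if "j < m" for j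
      by (rule mp[OF spec[OF B0] that])
    \<comment> \<open>Read off Newton's identity and \<open>sum_card_roots_of\<close>: the index
      \<open>e'\<close> for length \<open>m - k\<close> feeds the index \<open>gcd k e'\<close>,
      with the factor \<open>n / m\<close>.\<close>
    define b where "b e = n / m * (\<Sum>k=1..m. \<Sum>e'\<le>m - k. B (m - k) e' * of_bool (gcd k e' = e))"
      for e
    \<comment> \<open>A general \<open>w\<close> serves both conjuncts: once it is a root count,
      once the indicator of divisibility by \<open>d\<close>.\<close>
    have push: "(\<Sum>e\<le>m. b e * w e) = n / m * (\<Sum>k=1..m. \<Sum>e'\<le>m - k. B (m - k) e' * w (gcd k e'))"
      for w :: "nat \<Rightarrow> real"
    proof -
      have "(\<Sum>e\<le>m. b e * w e)
          = n / m * (\<Sum>e\<le>m. \<Sum>k=1..m. \<Sum>e'\<le>m - k. B (m - k) e' * (of_bool (gcd k e' = e) * w e))"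
        by (simp add: b_def sum_distrib_left sum_distrib_right mult_ac
            del: sum_mult_of_bool_eq sum_of_bool_mult_eq)
      also have "(\<Sum>e\<le>m. \<Sum>k=1..m. \<Sum>e'\<le>m - k. B (m - k) e' * (of_bool (gcd k e' = e) * w e))
          = (\<Sum>k=1..m. \<Sum>e\<le>m. \<Sum>e'\<le>m - k. B (m - k) e' * (of_bool (gcd k e' = e) * w e))"
        by (rule sum.swap)
      also have "\<dots> = (\<Sum>k=1..m. \<Sum>e'\<le>m - k. \<Sum>e\<le>m. B (m - k) e' * (of_bool (gcd k e' = e) * w e))"
        by (intro sum.cong refl sum.swap)
      also have "\<dots> = (\<Sum>k=1..m. \<Sum>e'\<le>m - k. B (m - k) e' * w (gcd k e'))"
      proof (intro sum.cong refl)
        fix k e' assume "k \<in> {1..m}"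
        then have "gcd k e' \<le> m" by (auto intro: order_trans[OF gcd_le1_nat])
        then have "(\<Sum>e\<le>m. of_bool (gcd k e' = e) * w e) = w (gcd k e')"
          by (simp add: of_bool_def if_distrib[of "\<lambda>x. x * _"] sum.delta' cong: if_cong)
        then show "(\<Sum>e\<le>m. B (m - k) e' * (of_bool (gcd k e' = e) * w e)) = B (m - k) e' * w (gcd k e')"
          by (simp flip: sum_distrib_left)
      qed
      finally show ?thesis .
    qed
    have "real (card (fixed_sum_seqs G m h)) = (\<Sum>e\<le>m. b e * real (card (roots_of G e h)))"
      if h: "h \<in> carrier G" for h
    proof -
      have "m * real (card (fixed_sum_seqs G m h))
          = (\<Sum>k=1..m. \<Sum>g\<in>carrier G. real (card (fixed_sum_seqs G (m - k) (h \<otimes> inv (g [^] k)))))"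
        using newton_fixed_sum_seqs[OF fin h, of m]
        by (simp flip: of_nat_mult of_nat_sum)
      also have "\<dots> = (\<Sum>k=1..m. \<Sum>e\<le>m - k. B (m - k) e * (n * real (card (roots_of G (gcd k e) h))))"
      proof (rule sum.cong[OF refl])
        fix k assume k: "k \<in> {1..m}"
        have "(\<Sum>g\<in>carrier G. real (card (fixed_sum_seqs G (m - k) (h \<otimes> inv (g [^] k)))))
            = (\<Sum>g\<in>carrier G. \<Sum>e\<le>m - k. B (m - k) e * real (card (roots_of G e (h \<otimes> inv (g [^] k)))))"
          using B[of "m - k"] k h by (intro sum.cong refl) auto
        also have "\<dots> = (\<Sum>e\<le>m - k. \<Sum>g\<in>carrier G. B (m - k) e * real (card (roots_of G e (h \<otimes> inv (g [^] k)))))"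
          by (rule sum.swap)
        also have "\<dots> = (\<Sum>e\<le>m - k. B (m - k) e
            * real (\<Sum>g\<in>carrier G. card (roots_of G e (h \<otimes> inv (g [^] k)))))"
          by (simp add: sum_distrib_left)
        also have "\<dots> = (\<Sum>e\<le>m - k. B (m - k) e * (n * real (card (roots_of G (gcd k e) h))))"
          using fin h by (simp add: sum_card_roots_of n_def)
        finally show "(\<Sum>g\<in>carrier G. real (card (fixed_sum_seqs G (m - k) (h \<otimes> inv (g [^] k)))))
            = (\<Sum>e\<le>m - k. B (m - k) e * (n * real (card (roots_of G (gcd k e) h))))" .
      qed
      also have "\<dots> = m * (\<Sum>e\<le>m. b e * real (card (roots_of G e h)))"
        using False by (simp add: push sum_distrib_left mult_ac)
      finally show ?thesis using False by simp
    qed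
    moreover have "(\<Sum>e\<le>m. b e * of_bool (d dvd e))
        = (if d dvd m then real ((order G div d + m div d - 1) choose (m div d)) / n else 0)"
      if d: "0 < d" "d dvd order G" for d
    proof -
      define r where "r = order G div d"
      define t where "t j = (if d dvd j then real ((r + j div d - 1) choose (j div d)) / n else 0)" for j
      have r: "order G = d * r" using d by (simp add: r_def)
      then have "0 < r" using n by (cases r) (simp_all add: n_def)
      have "(\<Sum>e\<le>m. b e * of_bool (d dvd e)) = n / m * (\<Sum>k=1..m. of_bool (d dvd k) * t (m - k))"
      proof -
        have "(\<Sum>e\<le>m - k. B (m - k) e * of_bool (d dvd gcd k e)) = of_bool (d dvd k) * t (m - k)"
          if "k \<in> {1..m}" for k
        proof -
          have "(\<Sum>e\<le>m - k. B (m - k) e * of_bool (d dvd gcd k e))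
              = of_bool (d dvd k) * (\<Sum>e\<le>m - k. B (m - k) e * of_bool (d dvd e))"
            by (simp add: sum_distrib_left)
          also have "(\<Sum>e\<le>m - k. B (m - k) e * of_bool (d dvd e)) = t (m - k)"
            using B[of "m - k"] that d by (simp add: t_def r_def n_def)
          finally show ?thesis .
        qed
        then show ?thesis by (simp add: push)
      qed
      also have "\<dots> = t m"
      proof (cases "d dvd m")
        case False
        then have "\<not> (d dvd k \<and> d dvd m - k)" if "k \<in> {1..m}" for k
          using that dvd_diffD[of d m k] by auto
        then have "of_bool (d dvd k) * t (m - k) = 0" if "k \<in> {1..m}" for k
          using that by (auto simp: t_def)
        then have "(\<Sum>k=1..m. of_bool (d dvd k) * t (m - k)) = 0"
          by (intro sum.neutral) auto
        then show ?thesis using False by (simp add: t_def)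
      next
        case True
        then obtain s where s: "m = d * s" by blast
        then have "0 < s" using \<open>m \<noteq> 0\<close> by (cases s) auto
        have "(\<Sum>k=1..m. of_bool (d dvd k) * t (m - k)) = (\<Sum>k\<in>{k \<in> {1..m}. d dvd k}. t (m - k))"
          by (rule sum.mono_neutral_cong_right) auto
        also have "\<dots> = (\<Sum>j<s. real ((r + j - 1) choose j) / n)"
        \<comment> \<open>The multiples of \<open>d\<close> are traversed backwards,
          \<open>k = d * (s - j)\<close>; as \<open>k\<close> is positive, \<open>j\<close> stays
          below \<open>s\<close>.\<close>
        proof (rule sum.reindex_bij_witness[of _ "\<lambda>j. d * (s - j)" "\<lambda>k. s - k div d"])
          fix k assume "k \<in> {k \<in> {1..m}. d dvd k}"
          then obtain i where i: "k = d * i" "0 < i" "i \<le> s" using s d by auto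
          then show "d * (s - (s - k div d)) = k" "s - k div d \<in> {..<s}" using d by auto
          have "m - k = d * (s - i)" using i s by (simp add: diff_mult_distrib2)
          then show "real ((r + (s - k div d) - 1) choose (s - k div d)) / n = t (m - k)"
            using i d by (simp add: t_def)
        qed (use d s in \<open>auto simp: Suc_le_eq\<close>)
        also have "\<dots> = real (\<Sum>j<s. (r + j - 1) choose j) / n"
          by (simp add: sum_divide_distrib)
        finally have "n / m * (\<Sum>k=1..m. of_bool (d dvd k) * t (m - k))
            = real (r * (\<Sum>j<s. (r + j - 1) choose j)) / (m * r)"
          using n \<open>0 < r\<close> by simp
        also have "\<dots> = real ((r + s - 1) choose s) / n"
          unfolding sum_binomial_lower[OF \<open>0 < r\<close> \<open>0 < s\<close>]
          using \<open>0 < s\<close> \<open>0 < d\<close> by (simp add: n_def r s)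
        finally show ?thesis using s d by (simp add: t_def)
      qed
      finally show ?thesis by (simp add: t_def r_def)
    qed
    ultimately have "?P m b" by (simp add: n_def)
    then show ?thesis by (intro exI[of _ b])
  qed
qed

section \<open>The closed formula for zero-sum sequences\<close>

lemma sum_num_of_order_divisors:
  assumes fin: "finite (carrier G)" and e: "0 < e"
  shows "(\<Sum>d | d dvd e. num_of_order G d * f d) = (\<Sum>x | x \<in> carrier G \<and> ord x dvd e. f (ord x))"
proof -
  have "(\<Sum>x | x \<in> carrier G \<and> ord x dvd e. f (ord x))
      = (\<Sum>d | d dvd e. \<Sum>x | x \<in> {x \<in> carrier G. ord x dvd e} \<and> ord x = d. f (ord x))"
    using fin e by (intro sum.group[symmetric]) auto
  also have "\<dots> = (\<Sum>d | d dvd e. num_of_order G d * f d)"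
  proof (rule sum.cong[OF refl])
    fix d assume "d \<in> {d. d dvd e}"
    then have "{x. x \<in> {x \<in> carrier G. ord x dvd e} \<and> ord x = d} = {x \<in> carrier G. ord x = d}"
      by auto
    then show "(\<Sum>x | x \<in> {x \<in> carrier G. ord x dvd e} \<and> ord x = d. f (ord x))
        = num_of_order G d * f d"
      by (simp add: num_of_order_def)
  qed
  finally show ?thesis by simp
qed

lemma roots_of_one: "roots_of G e \<one> = {x \<in> carrier G. ord x dvd e}"
  by (auto simp: roots_of_def pow_eq_id)

lemma sum_num_of_order:
  assumes "finite (carrier G)" "0 < e"
  shows "(\<Sum>d | d dvd e. num_of_order G d) = card (roots_of G e \<one>)"
  using sum_num_of_order_divisors[OF assms, of "\<lambda>_. 1"] by (simp add: roots_of_one)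

text \<open>The expansion at \<open>\<one>\<close> is rewritten as a sum over group elements and
  grouped by their order. The factor \<open>order G + m\<close> makes the terms symmetric: for
  \<open>order G = d * r\<close> and \<open>m = d * s\<close>,
  \<open>(r + s) * ((r + s - 1) choose s)\<close> equals
  \<open>r * ((r + s) choose r)\<close>.\<close>

theorem card_zero_sum_seqs:
  assumes fin: "finite (carrier G)"
  shows "(order G + m) * card (zero_sum_seqs G m)
    = (\<Sum>d | d dvd gcd (order G) m. num_of_order G d * ((order G div d + m div d) choose (order G div d)))"
proof -
  define n where "n = order G"
  have n: "0 < n" using fin by (simp add: n_def order_gt_0_iff_finite)
  obtain b where b: "\<forall>h\<in>carrier G. real (card (fixed_sum_seqs G m h))
        = (\<Sum>e\<le>m. b e * real (card (roots_of G e h)))"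
      "\<And>d. \<lbrakk>0 < d; d dvd n\<rbrakk> \<Longrightarrow> (\<Sum>e\<le>m. b e * of_bool (d dvd e))
        = (if d dvd m then real ((n div d + m div d - 1) choose (m div d)) / real n else 0)"
    using fixed_sum_seqs_expansion[OF fin, of m] unfolding n_def by blast
  have ord: "0 < ord x" "ord x dvd n" if "x \<in> carrier G" for x
    using that fin ord_dvd_group_order[OF that] ord_ge_1[OF fin that] by (auto simp: n_def)
  have "real (card (zero_sum_seqs G m)) = (\<Sum>e\<le>m. b e * real (card (roots_of G e \<one>)))"
    using b(1) by (simp add: zero_sum_seqs_def fixed_sum_seqs_def)
  also have "\<dots> = (\<Sum>e\<le>m. \<Sum>x\<in>carrier G. b e * of_bool (ord x dvd e))"
    using fin by (simp add: roots_of_one sum_of_bool_eq Int_def flip: sum_distrib_left)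
  also have "\<dots> = (\<Sum>x\<in>carrier G. \<Sum>e\<le>m. b e * of_bool (ord x dvd e))"
    by (rule sum.swap)
  also have "\<dots> = (\<Sum>x\<in>carrier G. if ord x dvd m
      then real ((n div ord x + m div ord x - 1) choose (m div ord x)) / real n else 0)"
    using b(2) ord by (intro sum.cong refl) auto
  also have "\<dots> = (\<Sum>x | x \<in> carrier G \<and> ord x dvd gcd n m.
      real ((n div ord x + m div ord x - 1) choose (m div ord x)) / real n)"
    using fin ord by (intro sum.mono_neutral_cong_right) auto
  finally have "real (n + m) * real (card (zero_sum_seqs G m))
      = real (n + m) * (\<Sum>x | x \<in> carrier G \<and> ord x dvd gcd n m.
          real ((n div ord x + m div ord x - 1) choose (m div ord x)) / real n)"
    by (rule arg_cong)
  also have "\<dots> = (\<Sum>x | x \<in> carrier G \<and> ord x dvd gcd n m.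
      real ((n div ord x + m div ord x) choose (n div ord x)))"
    unfolding sum_distrib_left
  proof (rule sum.cong[OF refl])
    fix x assume "x \<in> {x \<in> carrier G. ord x dvd gcd n m}"
    then obtain r s where rs: "n = ord x * r" "m = ord x * s" and x: "0 < ord x"
      using ord by (auto elim!: dvdE)
    have "0 < r" using rs n by (cases r) auto
    then have "r * ((r + s) choose r) = (r + s) * ((r + s - 1) choose (r - 1))"
      by (rule times_binomial_minus1_eq)
    also have "(r + s - 1) choose (r - 1) = (r + s - 1) choose s"
      using \<open>0 < r\<close> binomial_symmetric[of s "r + s - 1"] by simp
    finally have "real r * real ((r + s) choose r) = real (r + s) * real ((r + s - 1) choose s)"
      by (simp only: flip: of_nat_mult)
    moreover have "real (n + m) = real (ord x) * real (r + s)" "real n = real (ord x) * real r"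
      by (simp_all add: rs distrib_left)
    moreover have "n div ord x = r" "m div ord x = s" using rs x by simp_all
    ultimately show "real (n + m) * (real ((n div ord x + m div ord x - 1) choose (m div ord x)) / real n)
        = real ((n div ord x + m div ord x) choose (n div ord x))"
      using \<open>0 < r\<close> x by (simp add: divide_simps mult.commute del: of_nat_add)
  qed
  finally have "real ((n + m) * card (zero_sum_seqs G m))
      = real (\<Sum>x | x \<in> carrier G \<and> ord x dvd gcd n m. (n div ord x + m div ord x) choose (n div ord x))"
    by simp
  then have "(n + m) * card (zero_sum_seqs G m)
      = (\<Sum>x | x \<in> carrier G \<and> ord x dvd gcd n m. (n div ord x + m div ord x) choose (n div ord x))"
    by (simp only: of_nat_eq_iff)
  also have "\<dots> = (\<Sum>d | d dvd gcd n m. num_of_order G d * ((n div d + m div d) choose (n div d)))"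
    using n by (intro sum_num_of_order_divisors[OF fin, symmetric]) simp
  finally show ?thesis by (simp only: n_def)
qed

section \<open>Torsion subgroups and the profile of a finite abelian group\<close>

text \<open>Bezout exponents with \<open>a * s = b * t + 1\<close> split a root \<open>z\<close> of
  the product: \<open>z [^] (a * s)\<close> is killed by \<open>b\<close>, and the inverse of
  \<open>z [^] (b * t)\<close> is killed by \<open>a\<close>.\<close>

lemma card_roots_of_mult:
  assumes cop: "coprime a b" and pos: "0 < a"
  shows "card (roots_of G (a * b) \<one>) = card (roots_of G a \<one>) * card (roots_of G b \<one>)"
proof -
  obtain s t where st: "a * s = b * t + 1"
    using bezout_nat[of a b] pos cop by auto
  have decomp: "z = z [^] (a * s) \<otimes> inv (z [^] (b * t))" if "z \<in> carrier G" for z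
  proof -
    have "z [^] (a * s) = z \<otimes> z [^] (b * t)"
      unfolding st using that by (simp add: nat_pow_mult[symmetric] m_comm)
    then show ?thesis using that by (simp add: m_assoc)
  qed
  have "bij_betw (\<lambda>(x, y). x \<otimes> y) (roots_of G a \<one> \<times> roots_of G b \<one>) (roots_of G (a * b) \<one>)"
  proof (rule bij_betw_byWitness[where f' = "\<lambda>z. (inv (z [^] (b * t)), z [^] (a * s))"])
    have a: "x [^] (a * j) = \<one>" if "x \<in> roots_of G a \<one>" for x j
      using that by (simp add: roots_of_def nat_pow_pow[symmetric])
    have b: "x [^] (b * j) = \<one>" if "x \<in> roots_of G b \<one>" for x j
      using that by (simp add: roots_of_def nat_pow_pow[symmetric])
    have ab: "x [^] (a * (b * j)) = \<one>" if "x \<in> roots_of G (a * b) \<one>" for x j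
      using that by (simp add: roots_of_def nat_pow_pow[symmetric] mult.assoc[symmetric])
    have ra: "inv (x [^] (b * t)) = x" if "x \<in> roots_of G a \<one>" for x
    proof -
      have "x \<in> carrier G" using that by (simp add: roots_of_def)
      then show ?thesis using decomp[of x] a[OF that, of s] by simp
    qed
    have rb: "x [^] (a * s) = x" if "x \<in> roots_of G b \<one>" for x
    proof -
      have "x \<in> carrier G" using that by (simp add: roots_of_def)
      then show ?thesis using decomp[of x] b[OF that, of t] by simp
    qed
    show "\<forall>p\<in>roots_of G a \<one> \<times> roots_of G b \<one>.
        (\<lambda>z. (inv (z [^] (b * t)), z [^] (a * s))) ((\<lambda>(x, y). x \<otimes> y) p) = p"
    proof (rule ballI, elim SigmaE, simp only: prod.case)
      fix x y assume xy: "x \<in> roots_of G a \<one>" "y \<in> roots_of G b \<one>"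
      then have "x \<in> carrier G" "y \<in> carrier G" by (auto simp: roots_of_def)
      then show "(\<lambda>z. (inv (z [^] (b * t)), z [^] (a * s))) (x \<otimes> y) = (x, y)"
        using a[OF xy(1), of s] b[OF xy(2), of t] ra[OF xy(1)] rb[OF xy(2)]
        by (simp add: nat_pow_distrib)
    qed
    show "\<forall>z\<in>roots_of G (a * b) \<one>.
        (\<lambda>(x, y). x \<otimes> y) (inv (z [^] (b * t)), z [^] (a * s)) = z"
      using decomp by (auto simp: roots_of_def m_comm)
    show "(\<lambda>(x, y). x \<otimes> y) ` (roots_of G a \<one> \<times> roots_of G b \<one>) \<subseteq> roots_of G (a * b) \<one>"
    proof clarify
      fix x y assume xy: "x \<in> roots_of G a \<one>" "y \<in> roots_of G b \<one>"
      then have "x \<in> carrier G" "y \<in> carrier G" by (auto simp: roots_of_def)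
      moreover have "y [^] (a * b) = \<one>" using b[OF xy(2), of a] by (simp add: mult.commute)
      ultimately show "x \<otimes> y \<in> roots_of G (a * b) \<one>"
        using a[OF xy(1), of b] by (simp add: roots_of_def nat_pow_distrib)
    qed
    show "(\<lambda>z. (inv (z [^] (b * t)), z [^] (a * s))) ` roots_of G (a * b) \<one>
        \<subseteq> roots_of G a \<one> \<times> roots_of G b \<one>"
    proof (rule image_subsetI)
      fix z assume z: "z \<in> roots_of G (a * b) \<one>"
      then have c: "z \<in> carrier G" by (simp add: roots_of_def)
      have "inv (z [^] (b * t)) [^] a = \<one>"
        using c ab[OF z, of t] by (simp add: nat_pow_inv nat_pow_pow mult_ac)
      moreover have "(z [^] (a * s)) [^] b = \<one>"
        using c ab[OF z, of s] by (simp add: nat_pow_pow mult_ac)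
      ultimately show "(inv (z [^] (b * t)), z [^] (a * s)) \<in> roots_of G a \<one> \<times> roots_of G b \<one>"
        using c by (simp add: roots_of_def)
    qed
  qed
  then show ?thesis
    using bij_betw_same_card card_cartesian_product by metis
qed

lemma subgroup_roots_of_one: "subgroup (roots_of G e \<one>) G"
proof (rule subgroupI)
  have "\<one> \<in> roots_of G e \<one>" by (simp add: roots_of_def)
  then show "roots_of G e \<one> \<noteq> {}" by blast
qed (auto simp: roots_of_def nat_pow_distrib nat_pow_inv)

text \<open>Sylow's theorem provides a subgroup of order \<open>q ^ k\<close>. It lies in the
  subgroup of these roots, and Lagrange's theorem applies there.\<close>

lemma prime_power_dvd_card_roots_of:
  assumes fin: "finite (carrier G)" and q: "prime q" and dvd: "q ^ k dvd order G"
  shows "q ^ k dvd card (roots_of G (q ^ k) \<one>)"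
proof -
  let ?R = "roots_of G (q ^ k) \<one>"
  obtain S where S: "subgroup S G" "card S = q ^ k"
    using sylow_thm[OF q group_axioms _ fin] dvd by (metis dvdE)
  interpret S: group "G\<lparr>carrier := S\<rparr>" using S(1) by (rule subgroup_imp_group)
  have "finite S" using S(1) fin by (meson finite_subset subgroup.subset)
  have "x [^] (q ^ k) = \<one>" if "x \<in> S" for x
    using S.pow_order_eq_1[of x] that S by (simp add: order_def flip: nat_pow_consistent)
  then have sub: "S \<subseteq> ?R" using subgroup.subset[OF S(1)] by (auto simp: roots_of_def)
  interpret R: group "G\<lparr>carrier := ?R\<rparr>"
    using subgroup_roots_of_one by (rule subgroup_imp_group)
  have "subgroup S (G\<lparr>carrier := ?R\<rparr>)"
    using S(1) subgroup_roots_of_one sub by (rule subgroup_incl)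
  then have "card (rcosets\<^bsub>G\<lparr>carrier := ?R\<rparr>\<^esub> S) * card S = order (G\<lparr>carrier := ?R\<rparr>)"
    by (rule R.lagrange)
  then have "card (rcosets\<^bsub>G\<lparr>carrier := ?R\<rparr>\<^esub> S) * q ^ k = card ?R"
    by (simp add: order_def S(2))
  then show ?thesis by (metis dvd_triv_right)
qed

lemma order_profile_num_of_order:
  assumes fin: "finite (carrier G)"
  shows "order_profile (order G) (num_of_order G)"
proof
  show pos: "0 < order G" using fin by (simp add: order_gt_0_iff_finite)
  have "{x \<in> carrier G. ord x = 1} = {\<one>}" using ord_eq_1 by auto
  then show "num_of_order G 1 = 1" by (simp add: num_of_order_def)
  have "card (roots_of G (order G) \<one>) \<le> order G"
    unfolding order_def using fin by (intro card_mono) (auto simp: roots_of_def)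
  then show "(\<Sum>d | d dvd order G. num_of_order G d) \<le> order G"
    using fin pos by (simp add: sum_num_of_order)
  show "(\<Sum>d | d dvd a * b. num_of_order G d)
      = (\<Sum>d | d dvd a. num_of_order G d) * (\<Sum>d | d dvd b. num_of_order G d)"
    if "coprime a b" "0 < a" "0 < b" for a b
    using that fin by (simp add: sum_num_of_order card_roots_of_mult)
  show "q ^ k dvd (\<Sum>d | d dvd q ^ k. num_of_order G d)"
    if "prime q" "q ^ k dvd order G" for q k
    using that fin by (simp add: sum_num_of_order prime_power_dvd_card_roots_of prime_gt_0_nat)
qed

end

section \<open>Equality of the numbers of zero-sum sequences\<close>

theorem theorem1p1:
  fixes G :: "('a, 'c) monoid_scheme" and H :: "('b, 'd) monoid_scheme"
  assumes "comm_group G" and "finite (carrier G)"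
    and "comm_group H" and "finite (carrier H)"
  shows "card (zero_sum_seqs G (order H)) = card (zero_sum_seqs H (order G)) \<longleftrightarrow>
    (\<forall>d. d > 0 \<and> d dvd gcd (order G) (order H) \<longrightarrow> num_of_order G d = num_of_order H d)"
proof -
  define n where "n = order G"
  define m where "m = order H"
  define P where "P = num_of_order G"
  define Q where "Q = num_of_order H"
  define f where "f d = (n div d + m div d) choose (n div d)" for d
  interpret G: order_profile n P
    unfolding n_def P_def using assms by (intro comm_group.order_profile_num_of_order)
  interpret H: order_profile m Q
    unfolding m_def Q_def using assms by (intro comm_group.order_profile_num_of_order)
  \<comment> \<open>The weights are symmetric in \<open>n\<close> and \<open>m\<close>, so the
    formulas for both groups share the weights \<open>f d\<close> as well as the factor
    \<open>n + m\<close>.\<close>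
  have sym: "(m div d + n div d) choose (m div d) = f d" for d
    using binomial_symmetric[of "m div d" "m div d + n div d"] by (simp add: f_def add.commute)
  have "(n + m) * card (zero_sum_seqs G m) = (\<Sum>d | d dvd gcd n m. P d * f d)"
    using comm_group.card_zero_sum_seqs[OF assms(1,2), of m] by (simp add: n_def P_def f_def)
  moreover have "(n + m) * card (zero_sum_seqs H n) = (\<Sum>d | d dvd gcd n m. Q d * f d)"
    using comm_group.card_zero_sum_seqs[OF assms(3,4), of n]
    by (simp add: sym gcd.commute add.commute flip: m_def Q_def)
  moreover have "card (zero_sum_seqs G m) = card (zero_sum_seqs H n) \<longleftrightarrow>
      (n + m) * card (zero_sum_seqs G m) = (n + m) * card (zero_sum_seqs H n)"
    using G.pos by simp
  moreover have "(\<Sum>d | d dvd gcd n m. P d * f d) = (\<Sum>d | d dvd gcd n m. Q d * f d) \<longleftrightarrow>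
      (\<forall>d. d > 0 \<and> d dvd gcd n m \<longrightarrow> P d = Q d)"
  proof
    assume eq: "(\<Sum>d | d dvd gcd n m. P d * f d) = (\<Sum>d | d dvd gcd n m. Q d * f d)"
    show "\<forall>d. d > 0 \<and> d dvd gcd n m \<longrightarrow> P d = Q d"
    proof (rule ccontr)
      assume "\<not> ?thesis"
      then have ex: "\<exists>d. d dvd gcd n m \<and> P d \<noteq> Q d" by blast
      define L where "L = (LEAST d. d dvd gcd n m \<and> P d \<noteq> Q d)"
      have "L dvd gcd n m \<and> P L \<noteq> Q L" unfolding L_def using ex by (rule LeastI_ex)
      moreover have "L \<le> d" if "d dvd gcd n m" "P d \<noteq> Q d" for d
        unfolding L_def using that by (intro Least_le) auto
      ultimately interpret least_discrepancy n P m Q L by unfold_locales auto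
      have "int (\<Sum>d | d dvd gcd n m. P d * f d) = int (\<Sum>d | d dvd gcd n m. Q d * f d)"
        using eq by simp
      then show False using weighted_sum_ne by (simp add: f_def)
    qed
  next
    assume *: "\<forall>d. d > 0 \<and> d dvd gcd n m \<longrightarrow> P d = Q d"
    have "d > 0" if "d dvd gcd n m" for d using that G.pos by (auto intro!: gr0I)
    then show "(\<Sum>d | d dvd gcd n m. P d * f d) = (\<Sum>d | d dvd gcd n m. Q d * f d)"
      using * by (intro sum.cong refl) auto
  qed
  ultimately show ?thesis by (simp add: n_def m_def P_def Q_def)
qed

end
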